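(* Let $A$ and $B$ be functions analytic in both $x$ and $y$ (on a neighbourhood of $[-1,1]\times[-1,1]$), with $A(x,x)=-\frac{1}{2\pi}$ for all $x\in[-1,1]$, so that $\Phi(x,y)=A(x,y)\log|x-y|+B(x,y)$ is the restriction to $[-1,1]$ of a fundamental solution. Let $\lambda\in\mathbb{R}$ and let $\mathcal{R}$ be the infinite diagonal matrix $$\mathcal{R}=2\,\mathrm{diag}\left(\tfrac{1}{\log 2},1,2,3,\ldots\right):\ell^2_\lambda\to\ell^2_{\lambda-1}.$$ Then $$\left(\mathcal{L}_{(-1,1)}[\pi A]+\Sigma_{(-1,1)}[\pi B]\right)\mathcal{R}=I+\mathcal{K},$$ where $\mathcal{K}:\ell^2_\lambda\to\ell^2_\lambda$ is compact.
   Context: For $\lambda\in\mathbb{R}$, $\ell^2_\lambda\subset\mathbb{C}^\infty$ is the Banach space of sequences ${\bf u}=(u_0,u_1,\ldots)$ with norm $\|{\bf u}\|_{\ell^2_\lambda}=\left(\sum_{k=0}^\infty|u_k|^2(k+1)^{2\lambda}\right)^{1/2}<\infty$. $T_n$ denotes the Chebyshev polynomial of the first kind, $T_n(\cos\theta)=\cos n\theta$. A sequence ${\bf u}$ represents the density $u(y)=\sum_n u_n T_n(y)/\sqrt{1-y^2}$, and operators map into coefficients of expansions $\sum_n f_nT_n(x)$. $\mathcal{M}_0[a]$ is the infinite matrix of multiplication by $a$ in the basis $T_0,T_1,\ldots$: if $g=\sum_n g_nT_n$, then $\mathcal{M}_0[a]$ sends $(g_n)$ to the Chebyshev coefficients of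 $ag$. $\mathcal{L}_{(-1,1)}=\mathrm{diag}(-\log 2,-1,-\frac12,-\frac13,\ldots)$, the matrix of $u\mapsto\frac1\pi\int_{-1}^1\log|y-x|\,u(y)\,dy$ from the basis $T_n/\sqrt{1-y^2}$ to the basis $T_n$. $\Sigma_{(-1,1)}=(1,0,0,\ldots)$ is the functional $u\mapsto\frac1\pi\int_{-1}^1u(y)\,dy$ in the basis $T_n/\sqrt{1-y^2}$; its scalar value is identified with the coefficient sequence of the corresponding constant function, i.e. $\Sigma_{(-1,1)}{\bf u}=(u_0,0,0,\ldots)^\top$. For a bivariate kernel $K(x,y)=\sum_i a_i(x)b_i(y)$ (a finite sum, or for analytic $K$ its convergent bivariate Chebyshev expansion), $$\mathcal{L}_{(-1,1)}[K]:=\sum_i\mathcal{M}_0[a_i]\,\mathcal{L}_{(-1,1)}\,\mathcal{M}_0[b_i],\qquad \Sigma_{(-1,1)}[K]:=\sum_i\mathcal{M}_0[a_i]\,\Sigma_{(-1,1)}\,\mathcal{M}_0[b_i].$$ Thus $\mathcal{L}_{(-1,1)}[\pi A]+\Sigma_{(-1,1)}[\pi B]$ is the matrix of $u\mapsto\int_{-1}^1\Phi(x,y)u(y)\,dy$ in these bases. *)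

theory Defs
  imports "HOL-Analysis.Analysis"
begin

definition wl2 :: "real \<Rightarrow> (nat \<Rightarrow> complex) set" where
  "wl2 lam = {u. (\<lambda>k. (cmod (u k))\<^sup>2 * (real k + 1) powr (2 * lam)) summable_on UNIV}"

definition wl2_norm :: "real \<Rightarrow> (nat \<Rightarrow> complex) \<Rightarrow> real" where
  "wl2_norm lam u = sqrt (\<Sum>\<^sub>\<infinity>k. (cmod (u k))\<^sup>2 * (real k + 1) powr (2 * lam))"

definition wl2_dist :: "real \<Rightarrow> (nat \<Rightarrow> complex) \<Rightarrow> (nat \<Rightarrow> complex) \<Rightarrow> real" where
  "wl2_dist lam u v = wl2_norm lam (\<lambda>k. u k - v k)"

abbreviation wl2_topology :: "real \<Rightarrow> (nat \<Rightarrow> complex) topology" where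
  "wl2_topology lam \<equiv> Metric_space.mtopology (wl2 lam) (wl2_dist lam)"

lemma wl2_add_bound:
  assumes u: "u \<in> wl2 lam" and v: "v \<in> wl2 lam"
  shows "(\<lambda>k. u k + v k) \<in> wl2 lam"
    and "wl2_norm lam (\<lambda>k. u k + v k) \<le> wl2_norm lam u + wl2_norm lam v"
proof -
  define w where "w = (\<lambda>k. (real k + 1) powr lam)"
  have w0: "w k \<ge> 0" for k by (simp add: w_def)
  have wsq: "(real k + 1) powr (2 * lam) = (w k)\<^sup>2" for k
    by (simp add: w_def power2_eq_square flip: powr_add)
  let ?s = "\<lambda>x k. (cmod (x k))\<^sup>2 * (real k + 1) powr (2 * lam)"
  have fin: "(\<Sum>k\<in>F. ?s x k) = (L2_set (\<lambda>k. cmod (x k) * w k) F)\<^sup>2" for x F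
    by (simp add: L2_set_def wsq power_mult_distrib sum_nonneg)
  have le: "L2_set (\<lambda>k. cmod (x k) * w k) F \<le> wl2_norm lam x"
    if "x \<in> wl2 lam" "finite F" for x F
  proof -
    have "(\<Sum>k\<in>F. ?s x k) \<le> (\<Sum>\<^sub>\<infinity>k. ?s x k)"
      using that by (intro finite_sum_le_infsum) (auto simp: wl2_def)
    then show ?thesis
      unfolding fin wl2_norm_def by (simp add: real_le_rsqrt)
  qed
  have main: "(\<Sum>k\<in>F. ?s (\<lambda>k. u k + v k) k) \<le> (wl2_norm lam u + wl2_norm lam v)\<^sup>2"
    if F: "finite F" for F
  proof -
    have "L2_set (\<lambda>k. cmod (u k + v k) * w k) F
        \<le> L2_set (\<lambda>k. cmod (u k) * w k + cmod (v k) * w k) F"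
      by (intro L2_set_mono) (auto simp: w0 norm_triangle_ineq mult_right_mono simp flip: distrib_right)
    also have "\<dots> \<le> L2_set (\<lambda>k. cmod (u k) * w k) F + L2_set (\<lambda>k. cmod (v k) * w k) F"
      by (rule L2_set_triangle_ineq)
    also have "\<dots> \<le> wl2_norm lam u + wl2_norm lam v"
      using le[OF u F] le[OF v F] by simp
    finally show ?thesis
      unfolding fin by (simp add: power_mono)
  qed
  have sm: "?s (\<lambda>k. u k + v k) summable_on UNIV"
    using main by (intro nonneg_bdd_above_summable_on bdd_aboveI2) auto
  then show "(\<lambda>k. u k + v k) \<in> wl2 lam" by (simp add: wl2_def)
  have "(\<Sum>\<^sub>\<infinity>k. ?s (\<lambda>k. u k + v k) k) \<le> (wl2_norm lam u + wl2_norm lam v)\<^sup>2"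
    using sm main by (intro infsum_le_finite_sums) auto
  moreover have "0 \<le> wl2_norm lam u" "0 \<le> wl2_norm lam v"
    by (auto simp: wl2_norm_def intro!: infsum_nonneg)
  ultimately show "wl2_norm lam (\<lambda>k. u k + v k) \<le> wl2_norm lam u + wl2_norm lam v"
    unfolding wl2_norm_def[of lam "\<lambda>k. u k + v k"] by (intro real_le_lsqrt) auto
qed

lemma wl2_diff:
  assumes "u \<in> wl2 lam" "v \<in> wl2 lam"
  shows "(\<lambda>k. u k - v k) \<in> wl2 lam"
  using wl2_add_bound(1)[of u lam "\<lambda>k. - v k"] assms by (simp add: wl2_def)

lemma Metric_space_wl2: "Metric_space (wl2 lam) (wl2_dist lam)"
proof
  show "0 \<le> wl2_dist lam x y" for x y
    by (auto simp: wl2_dist_def wl2_norm_def intro!: infsum_nonneg)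
  show "wl2_dist lam x y = wl2_dist lam y x" for x y
    by (simp add: wl2_dist_def wl2_norm_def norm_minus_commute)
  show "wl2_dist lam x y = 0 \<longleftrightarrow> x = y" if "x \<in> wl2 lam" "y \<in> wl2 lam" for x y
  proof
    let ?f = "\<lambda>k. (cmod (x k - y k))\<^sup>2 * (real k + 1) powr (2 * lam)"
    assume "wl2_dist lam x y = 0"
    then have 0: "infsum ?f UNIV = 0" by (simp add: wl2_dist_def wl2_norm_def)
    have sm: "?f summable_on UNIV" using wl2_diff[OF that] by (simp add: wl2_def)
    have "?f k = 0" for k
      using 0 sm by (intro nonneg_infsum_le_0D[of ?f UNIV]) auto
    then show "x = y"
      by (auto simp: fun_eq_iff)
  qed (simp add: wl2_dist_def wl2_norm_def)
  show "wl2_dist lam x z \<le> wl2_dist lam x y + wl2_dist lam y z"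
    if "x \<in> wl2 lam" "y \<in> wl2 lam" "z \<in> wl2 lam" for x y z
    using wl2_add_bound(2)[OF wl2_diff[OF that(1,2)] wl2_diff[OF that(2,3)]]
    by (simp add: wl2_dist_def)
qed


type_synonym inf_mat = "nat \<Rightarrow> nat \<Rightarrow> complex"

definition mat_mult :: "inf_mat \<Rightarrow> inf_mat \<Rightarrow> inf_mat" (infixl "\<otimes>\<^sub>M" 70) where
  "(M \<otimes>\<^sub>M N) i j = (\<Sum>\<^sub>\<infinity>k. M i k * N k j)"

definition mat_add :: "inf_mat \<Rightarrow> inf_mat \<Rightarrow> inf_mat" (infixl "\<oplus>\<^sub>M" 65) where
  "(M \<oplus>\<^sub>M N) i j = M i j + N i j"

definition diag_mat :: "(nat \<Rightarrow> complex) \<Rightarrow> inf_mat" where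
  "diag_mat d i j = (if i = j then d i else 0)"

definition mat_app :: "inf_mat \<Rightarrow> (nat \<Rightarrow> complex) \<Rightarrow> nat \<Rightarrow> complex" where
  "mat_app M u i = (\<Sum>\<^sub>\<infinity>j. M i j * u j)"

text \<open>The convergence of every row sum is required explicitly, because a divergent
  \<^const>\<open>infsum\<close> is \<open>0\<close> by convention.\<close>

definition maps_wl2 :: "inf_mat \<Rightarrow> real \<Rightarrow> real \<Rightarrow> bool" where
  "maps_wl2 M lam mu \<longleftrightarrow>
     (\<forall>u\<in>wl2 lam. (\<forall>i. (\<lambda>j. M i j * u j) summable_on UNIV) \<and> mat_app M u \<in> wl2 mu)"

definition compact_on_wl2 :: "inf_mat \<Rightarrow> real \<Rightarrow> bool" where
  "compact_on_wl2 M lam \<longleftrightarrow> maps_wl2 M lam lam \<and>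
     compactin (wl2_topology lam)
       (wl2_topology lam closure_of (mat_app M ` {u \<in> wl2 lam. wl2_norm lam u \<le> 1}))"


fun cheb_T :: "nat \<Rightarrow> real \<Rightarrow> real" where
  "cheb_T 0 x = 1"
| "cheb_T (Suc 0) x = x"
| "cheb_T (Suc (Suc n)) x = 2 * x * cheb_T (Suc n) x - cheb_T n x"

lemma cheb_T_cos: "cheb_T n (cos t) = cos (real n * t)"
proof (induction n "cos t" rule: cheb_T.induct)
  case (3 n)
  have "cos (real (Suc (Suc n)) * t) + cos (real n * t) = 2 * cos t * cos (real (Suc n) * t)"
    using cos_add[of "real (Suc n) * t" t] cos_diff[of "real (Suc n) * t" t]
    by (simp add: algebra_simps)
  with 3 show ?case by simp
qed auto

text \<open>The coefficient \<open>f\<^sub>n\<close> in \<open>f = (\<Sum>n. f\<^sub>n T\<^sub>n)\<close> on \<open>[-1,1]\<close>, given by the orthogonality of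
  the \<open>T\<^sub>n\<close> for the weight \<open>1 / sqrt (1 - x\<^sup>2)\<close>; at the endpoints the integrand is \<open>0\<close> because
  of \<open>z / 0 = 0\<close>, which does not affect the integral.\<close>

definition cheb_coeff :: "(real \<Rightarrow> complex) \<Rightarrow> nat \<Rightarrow> complex" where
  "cheb_coeff f n = of_real ((if n = 0 then 1 else 2) / pi) *
     integral {-1..1} (\<lambda>x. f x * of_real (cheb_T n x) / of_real (sqrt (1 - x\<^sup>2)))"

text \<open>The coefficients in \<open>K(x,y) = (\<Sum>m n. k\<^sub>m\<^sub>n T\<^sub>m(x) T\<^sub>n(y))\<close>.\<close>

definition cheb_coeff2 :: "(real \<Rightarrow> real \<Rightarrow> complex) \<Rightarrow> nat \<Rightarrow> nat \<Rightarrow> complex" where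
  "cheb_coeff2 K m n = cheb_coeff (\<lambda>x. cheb_coeff (\<lambda>y. K x y) n) m"


text \<open>Column \<open>j\<close> of the multiplication matrix holds the coefficients of \<open>a T\<^sub>j\<close>.\<close>

definition mult_mat :: "(real \<Rightarrow> complex) \<Rightarrow> inf_mat" where
  "mult_mat a i j = cheb_coeff (\<lambda>x. a x * of_real (cheb_T j x)) i"

definition log_mat :: inf_mat where
  "log_mat = diag_mat (\<lambda>k. if k = 0 then - of_real (ln 2) else - 1 / of_nat k)"

text \<open>The functional \<open>(1,0,0,\<dots>)\<close>, whose value is regarded as a constant function.\<close>

definition sum_mat :: inf_mat where
  "sum_mat = diag_mat (\<lambda>k. if k = 0 then 1 else 0)"

text \<open>The sum over \<open>i\<close> of \<open>M\<^sub>0[a\<^sub>i] X M\<^sub>0[b\<^sub>i]\<close> for the bivariate Chebyshev expansion of \<open>K\<close>: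
  the index \<open>i\<close> is the pair \<open>(m,n)\<close>, with \<open>a\<^sub>i = k\<^sub>m\<^sub>n T\<^sub>m\<close> and \<open>b\<^sub>i = T\<^sub>n\<close>; the series of
  matrices is summed entrywise.\<close>

definition kernel_mat :: "inf_mat \<Rightarrow> (real \<Rightarrow> real \<Rightarrow> complex) \<Rightarrow> inf_mat" where
  "kernel_mat X K i j = (\<Sum>\<^sub>\<infinity>(m, n).
     (mult_mat (\<lambda>x. cheb_coeff2 K m n * of_real (cheb_T m x)) \<otimes>\<^sub>M X
        \<otimes>\<^sub>M mult_mat (\<lambda>y. of_real (cheb_T n y))) i j)"

definition log_kernel_mat :: "(real \<Rightarrow> real \<Rightarrow> complex) \<Rightarrow> inf_mat" where
  "log_kernel_mat K = kernel_mat log_mat K"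

definition sum_kernel_mat :: "(real \<Rightarrow> real \<Rightarrow> complex) \<Rightarrow> inf_mat" where
  "sum_kernel_mat K = kernel_mat sum_mat K"

definition R_mat :: inf_mat where
  "R_mat = diag_mat (\<lambda>k. 2 * (if k = 0 then 1 / of_real (ln 2) else of_nat k))"


text \<open>Analytic on a set means jointly complex differentiable on an open neighbourhood of it in
  two-dimensional complex space; \<open>p\<close> and \<open>q\<close> are the complex partial derivatives.\<close>

definition analytic2_on :: "(complex \<Rightarrow> complex \<Rightarrow> complex) \<Rightarrow> (complex \<times> complex) set \<Rightarrow> bool" where
  "analytic2_on f S \<longleftrightarrow> (\<exists>U. open U \<and> S \<subseteq> U \<and>
     (\<forall>z\<in>U. \<exists>p q. ((\<lambda>w. f (fst w) (snd w)) has_derivative (\<lambda>h. p * fst h + q * snd h)) (at z)))"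

end

theory Submission
  imports Defs "HOL-Complex_Analysis.Complex_Analysis"
begin

text \<open>Let \<open>k\<^sub>m\<^sub>n\<close> be the Chebyshev coefficients of \<open>\<pi>A\<close>. Since \<open>\<L>\<R> = -2I\<close>, replacing \<open>\<L> M\<^sub>0[T\<^sub>n] \<R>\<close>
  by \<open>M\<^sub>0[T\<^sub>n] \<L>\<R>\<close> in every term of the expansion gives \<open>-2 M\<^sub>0[\<pi>A(x,x)] = I\<close>, because
  \<open>\<pi>A(x,x) = -1/2\<close>. The commutator that is left has entries at \<open>(p,j)\<close> of size at most
  \<open>4(n+1)/(p+1)\<close> and vanishes unless \<open>\<bar>p - j\<bar> \<le> n\<close>. Analyticity makes \<open>k\<^sub>m\<^sub>n\<close> decay exponentially, so
  the entries of \<open>\<K>\<close> are \<open>O(s\<^bsup>\<bar>i-j\<bar>\<^esup> / (i+1))\<close> for some \<open>s < 1\<close>; the part coming from \<open>B\<close> is even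
  smaller. Such a matrix maps the unit ball of the weighted space into a Hilbert cube, which is
  compact.\<close>

subsection \<open>Chebyshev coefficients\<close>

text \<open>The shape of the entry bound serves two purposes. Exponential decay off the diagonal
  survives the weights \<open>(k + 1) powr lam\<close> for either sign of \<open>lam\<close>, since
  moving a weight from one index to another costs only a polynomial in their distance; so one bound,
  in which \<open>lam\<close> does not occur, settles every space. The factor
  \<open>1 / (i + 1)\<close> is square summable, which makes the cube compact in norm. It arises
  from \<open>log_eigen p * R_eigen j + 2 = 2 * (p - j) / p\<close> for positive \<open>p\<close>
  and \<open>j\<close>, where the distance of \<open>p\<close> and \<open>j\<close> is at most
  \<open>n\<close>; the growth in \<open>n\<close> is paid for by the decay of the coefficients. Two
  analytic inputs are needed. The commuted terms add up to multiplication by K(x,x) only if the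
  double expansion converges to K on the diagonal, hence the uniqueness theorem for Chebyshev
  coefficients. And the decay must be joint in m and n: it comes from one-variable contour shifts in
  each argument, combined through max m n \<ge> (m + n) / 2, so that no Cauchy formula in two
  variables enters.\<close>

lemma cheb_coeff_eq_cos_integral:
  assumes "continuous_on {-1..1} f"
  shows "cheb_coeff f n = of_real ((if n = 0 then 1 else 2) / pi) *
           integral {0..pi} (\<lambda>t. f (cos t) * of_real (cos (real n * t)))"
proof -
  define h where "h = (\<lambda>t. f (cos t) * of_real (cos (real n * t)) :: complex)"
  define H where "H = (\<lambda>u. integral {0..u} h)"
  have ch: "continuous_on {0..pi} h"
    unfolding h_def by (intro continuous_intros continuous_on_compose2[OF assms]) auto
  have cH: "continuous_on {0..pi} H"
    unfolding H_def by (intro indefinite_integral_continuous_1 integrable_continuous_real ch)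
  \<comment> \<open>The weight is unbounded at the endpoints, so the substitution x = cos t goes
    through the primitive \<open>- H (arccos x)\<close>, which is continuous on the closed interval
    and has to be differentiated only inside it.\<close>
  have "((\<lambda>x. f x * of_real (cheb_T n x) / of_real (sqrt (1 - x\<^sup>2))) has_integral
          - H (arccos 1) - - H (arccos (- 1))) {-1..1}"
  proof (rule fundamental_theorem_of_calculus_interior)
    show "continuous_on {-1..1} (\<lambda>x. - H (arccos x))"
      by (intro continuous_intros continuous_on_compose2[OF cH]) (auto simp: arccos_lbound arccos_ubound)
    fix x :: real assume x: "x \<in> {-1<..<1}"
    have "(H has_vector_derivative h (arccos x)) (at (arccos x) within {0..pi})"
      unfolding H_def
      by (rule integral_has_vector_derivative[OF ch]) (use x in \<open>auto simp: arccos_lbound arccos_ubound\<close>)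
    moreover have "at (arccos x) within {0..pi} = at (arccos x)"
      using x arccos_lt_bounded[of x] by (intro at_within_interior) simp
    ultimately have "(H has_vector_derivative h (arccos x)) (at (arccos x))"
      by metis
    moreover have "(arccos has_vector_derivative inverse (- sqrt (1 - x\<^sup>2))) (at x)"
      using x DERIV_arccos[of x] by (simp add: has_real_derivative_iff_has_vector_derivative)
    ultimately have "(H \<circ> arccos has_vector_derivative inverse (- sqrt (1 - x\<^sup>2)) *\<^sub>R h (arccos x)) (at x)"
      by (intro vector_diff_chain_at)
    then have "((\<lambda>x. - H (arccos x)) has_vector_derivative - (inverse (- sqrt (1 - x\<^sup>2)) *\<^sub>R h (arccos x))) (at x)"
      unfolding o_def by (rule has_vector_derivative_minus)
    moreover have "cheb_T n x = cos (real n * arccos x)"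
      using x cheb_T_cos[of n "arccos x"] by simp
    ultimately show "((\<lambda>x. - H (arccos x)) has_vector_derivative
        f x * of_real (cheb_T n x) / of_real (sqrt (1 - x\<^sup>2))) (at x)"
      using x by (simp add: h_def scaleR_conv_of_real divide_inverse mult_ac)
  qed simp
  then have "integral {-1..1} (\<lambda>x. f x * of_real (cheb_T n x) / of_real (sqrt (1 - x\<^sup>2))) = H pi"
    by (simp add: integral_unique H_def)
  then show ?thesis by (simp add: cheb_coeff_def H_def h_def)
qed

lemma cheb_T_eq_cos_arccos: "x \<in> {-1..1} \<Longrightarrow> cheb_T n x = cos (real n * arccos x)"
  using cheb_T_cos[of n "arccos x"] by simp

lemma abs_cheb_T_le_1: "x \<in> {-1..1} \<Longrightarrow> \<bar>cheb_T n x\<bar> \<le> 1"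
  by (simp add: cheb_T_eq_cos_arccos)

lemma continuous_on_cheb_T [continuous_intros]: "continuous_on S (cheb_T n)"
proof (induction n rule: induct_nat_012)
  case (ge2 n)
  have "cheb_T (Suc (Suc n)) = (\<lambda>x. 2 * x * cheb_T (Suc n) x - cheb_T n x)"
    by (rule ext) simp
  with ge2 show ?case by (auto intro!: continuous_intros)
next
  case 0
  have "cheb_T 0 = (\<lambda>x. 1)" by (rule ext) simp
  then show ?case by simp
next
  case 1
  have "cheb_T (Suc 0) = (\<lambda>x. x)" by (rule ext) simp
  then show ?case by simp
qed

section \<open>Index distance, product formula and orthogonality\<close>

text \<open>The absolute difference: subtraction on \<open>nat\<close> truncates, so at most one
  summand is nonzero. Staying in \<open>nat\<close> lets it serve as an index of
  \<open>cheb_T\<close> and as an exponent.\<close>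

definition ndist :: "nat \<Rightarrow> nat \<Rightarrow> nat" where
  "ndist m n = (m - n) + (n - m)"

lemma ndist_eq_0_iff [simp]: "ndist m n = 0 \<longleftrightarrow> m = n"
  by (auto simp: ndist_def)

lemma ndist_self [simp]: "ndist n n = 0"
  by (simp add: ndist_def)

lemma ndist_0_right [simp]: "ndist m 0 = m"
  by (simp add: ndist_def)

lemma ndist_commute: "ndist m n = ndist n m"
  by (simp add: ndist_def)

lemma ndist_le_iff: "ndist m n \<le> k \<longleftrightarrow> m \<le> n + k \<and> n \<le> m + k"
  unfolding ndist_def by linarith

lemma ndist_le_add: "ndist m n \<le> m + n"
  by (simp add: ndist_le_iff)

text \<open>Reverse triangle inequality. It keeps the lower index of the product formula within
  distance \<open>m\<close> of \<open>n\<close>, as the upper index \<open>m + n\<close> clearly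
  is.\<close>

lemma ndist_ndist_le: "ndist (ndist m n) n \<le> m"
  by (cases m n rule: le_cases) (simp_all add: ndist_def)

lemma cheb_T_mult:
  assumes "x \<in> {-1..1}"
  shows "cheb_T m x * cheb_T n x = (cheb_T (m + n) x + cheb_T (ndist m n) x) / 2"
proof -
  have "cos (real (ndist m n) * t) = cos (real m * t - real n * t)" for t
  proof (cases "m \<le> n")
    case True
    then have "real (ndist m n) * t = - (real m * t - real n * t)"
      by (simp add: ndist_def of_nat_diff algebra_simps)
    then show ?thesis by (simp only: cos_minus)
  qed (simp add: ndist_def of_nat_diff algebra_simps)
  then show ?thesis
    using assms by (simp add: cheb_T_eq_cos_arccos cos_times_cos algebra_simps)
qed

lemma of_real_cheb_T_mult:
  assumes "x \<in> {-1..1}"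
  shows "complex_of_real (cheb_T m x) * of_real (cheb_T n x)
    = (1 / 2) * (of_real (cheb_T (m + n) x) + of_real (cheb_T (ndist m n) x))"
proof -
  have "complex_of_real (cheb_T m x * cheb_T n x) = of_real ((cheb_T (m + n) x + cheb_T (ndist m n) x) / 2)"
    by (simp only: cheb_T_mult[OF assms])
  then show ?thesis by (simp only: of_real_mult of_real_divide of_real_add of_real_numeral) simp
qed

lemma cheb_coeff_cong:
  assumes "\<And>x. x \<in> {-1..1} \<Longrightarrow> f x = g x"
  shows "cheb_coeff f n = cheb_coeff g n"
  unfolding cheb_coeff_def using assms by (intro arg_cong2[where f = "(*)"] refl integral_cong) auto

lemma cheb_coeff_cmult: "cheb_coeff (\<lambda>x. c * f x) n = c * cheb_coeff f n"
  unfolding cheb_coeff_def by (simp add: mult.assoc flip: times_divide_eq_right)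

lemma integrable_cos_integrand:
  assumes "continuous_on {-1..1} f"
  shows "(\<lambda>t. f (cos t) * of_real (cos (real n * t)) :: complex) integrable_on {0..pi}"
  by (intro integrable_continuous_real continuous_intros continuous_on_compose2[OF assms]) auto

lemma cheb_coeff_add:
  assumes "continuous_on {-1..1} f" "continuous_on {-1..1} g"
  shows "cheb_coeff (\<lambda>x. f x + g x) n = cheb_coeff f n + cheb_coeff g n"
  using assms
  by (simp add: cheb_coeff_eq_cos_integral continuous_on_add distrib_right distrib_left
      Henstock_Kurzweil_Integration.integral_add integrable_cos_integrand)

lemma cheb_coeff_diff:
  assumes "continuous_on {-1..1} f" "continuous_on {-1..1} g"
  shows "cheb_coeff (\<lambda>x. f x - g x) n = cheb_coeff f n - cheb_coeff g n"
  using assms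
  by (simp add: cheb_coeff_eq_cos_integral continuous_on_diff left_diff_distrib right_diff_distrib
      Henstock_Kurzweil_Integration.integral_diff integrable_cos_integrand)

lemma cheb_coeff_sum:
  assumes "finite A" "\<And>p. p \<in> A \<Longrightarrow> continuous_on {-1..1} (f p)"
  shows "cheb_coeff (\<lambda>x. \<Sum>p\<in>A. f p x) n = (\<Sum>p\<in>A. cheb_coeff (f p) n)"
  using assms
proof (induction A rule: finite_induct)
  case empty
  show ?case by (simp add: cheb_coeff_def)
next
  case (insert p A)
  then show ?case by (simp add: cheb_coeff_add continuous_on_sum)
qed

text \<open>The factor 2 is the normalisation 2/pi times the length pi of the range of the angle.
  Coefficients are thus continuous in the sup norm, which justifies all passages to the limit
  below.\<close>

lemma norm_cheb_coeff_le:
  assumes "continuous_on {-1..1} f" "\<And>x. x \<in> {-1..1} \<Longrightarrow> norm (f x) \<le> B"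
  shows "norm (cheb_coeff f n) \<le> 2 * B"
proof -
  have B: "0 \<le> B" using assms(2)[of 0] norm_ge_zero[of "f 0"] by (simp del: norm_ge_zero)
  have "norm (integral {0..pi} (\<lambda>t. f (cos t) * of_real (cos (real n * t)))) \<le> integral {0..pi} (\<lambda>t. B)"
  proof (rule Henstock_Kurzweil_Integration.integral_norm_bound_integral)
    fix t :: real
    have "norm (f (cos t)) * \<bar>cos (real n * t)\<bar> \<le> B * 1"
      using B by (intro mult_mono assms) auto
    then show "norm (f (cos t) * of_real (cos (real n * t))) \<le> B"
      by (simp add: norm_mult)
  qed (auto intro: integrable_cos_integrand assms)
  then have "norm (cheb_coeff f n) \<le> norm (of_real ((if n = 0 then 1 else 2) / pi) :: complex) * (pi * B)"
    unfolding cheb_coeff_eq_cos_integral[OF assms(1)] norm_mult by (intro mult_left_mono) auto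
  also have "\<dots> \<le> (2 / pi) * (pi * B)"
    using B by (intro mult_right_mono) (auto simp: norm_divide divide_right_mono)
  finally show ?thesis by simp
qed

lemma integral_cos_nat:
  "integral {0..pi} (\<lambda>t. cos (real k * t)) = (if k = 0 then pi else 0)"
proof (cases "k = 0")
  case False
  have "((\<lambda>t. cos (real k * t)) has_integral (sin (real k * pi) / k - sin (real k * 0) / k)) {0..pi}"
    by (rule fundamental_theorem_of_calculus)
      (use False in \<open>auto intro!: derivative_eq_intros simp flip: has_real_derivative_iff_has_vector_derivative\<close>)
  then show ?thesis using False by (simp add: integral_unique mult.commute[of _ pi])
qed simp

text \<open>The two normalisations in \<open>cheb_coeff\<close> fit: for \<open>i = j = 0\<close>
  both cosines of the product formula integrate to pi, for \<open>i = j > 0\<close> only one of them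
  does.\<close>

lemma cheb_coeff_cheb_T:
  "cheb_coeff (\<lambda>x. of_real (cheb_T j x)) i = (if i = j then 1 else 0)"
proof -
  have c: "continuous_on {-1..1} (\<lambda>x. of_real (cheb_T j x) :: complex)"
    by (intro continuous_intros)
  have "cos (real j * t) * cos (real i * t) = (cos (real (j + i) * t) + cos (real (ndist j i) * t)) / 2" for t
    using cheb_T_mult[of "cos t" j i] by (simp add: cheb_T_cos)
  then have "(\<lambda>t. cos (real j * t) * cos (real i * t))
      = (\<lambda>t. (cos (real (j + i) * t) + cos (real (ndist j i) * t)) / 2)"
    by (rule ext)
  then have "integral {0..pi} (\<lambda>t. cos (real j * t) * cos (real i * t))
      = integral {0..pi} (\<lambda>t. (cos (real (j + i) * t) + cos (real (ndist j i) * t)) / 2)"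
    by (rule arg_cong)
  also have "\<dots> = (integral {0..pi} (\<lambda>t. cos (real (j + i) * t)) + integral {0..pi} (\<lambda>t. cos (real (ndist j i) * t))) / 2"
    by (subst Henstock_Kurzweil_Integration.integral_add[symmetric])
      (auto intro!: integrable_continuous_real continuous_intros)
  finally have *: "integral {0..pi} (\<lambda>t. cos (real j * t) * cos (real i * t))
      = ((if j + i = 0 then pi else 0) + (if ndist j i = 0 then pi else 0)) / 2"
    by (simp only: integral_cos_nat)
  have eq: "integral {0..pi} (\<lambda>t. complex_of_real (cheb_T j (cos t)) * of_real (cos (real i * t)))
      = of_real (integral {0..pi} (\<lambda>t. cos (real j * t) * cos (real i * t)))"
    unfolding cheb_T_cos of_real_mult[symmetric]
    by (subst integral_linear[OF _ bounded_linear_of_real, unfolded o_def])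
      (auto intro!: integrable_continuous_real continuous_intros)
  show ?thesis
    unfolding cheb_coeff_eq_cos_integral[OF c] eq * by (cases "i = j") auto
qed

text \<open>The Weierstrass M-test gives uniform convergence over finite subsets, and the
  coefficient functional is bounded in the sup norm. The index set is arbitrary so that single and
  double expansions are both covered.\<close>

lemma cheb_coeff_has_sum:
  assumes c: "\<And>p. p \<in> A \<Longrightarrow> continuous_on {-1..1} (g p)"
    and M: "\<And>p x. p \<in> A \<Longrightarrow> x \<in> {-1..1} \<Longrightarrow> norm (g p x) \<le> M p" "M summable_on A"
    and f: "\<And>x. x \<in> {-1..1} \<Longrightarrow> ((\<lambda>p. g p x) has_sum f x) A"
  shows "continuous_on {-1..1} f"
    and "((\<lambda>p. cheb_coeff (g p) n) has_sum cheb_coeff f n) A"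
proof -
  have u: "uniform_limit {-1..1} (\<lambda>F x. \<Sum>p\<in>F. g p x) f (finite_subsets_at_top A)"
    using M(1) f M(2) by (rule Weierstrass_m_test_general')
  have ev: "\<forall>\<^sub>F F in finite_subsets_at_top A. finite F \<and> F \<subseteq> A"
    using eventually_finite_subsets_at_top_weakI[of A "\<lambda>F. finite F \<and> F \<subseteq> A"] by simp
  show cf: "continuous_on {-1..1} f"
    by (rule uniform_limit_theorem[OF _ u])
      (use ev in \<open>auto elim!: eventually_mono intro!: continuous_on_sum c\<close>)
  show "((\<lambda>p. cheb_coeff (g p) n) has_sum cheb_coeff f n) A"
    unfolding has_sum_def
  proof (rule tendstoI)
    fix e :: real assume e: "0 < e"
    then have "\<forall>\<^sub>F F in finite_subsets_at_top A. \<forall>x\<in>{-1..1}. dist (\<Sum>p\<in>F. g p x) (f x) < e / 3"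
      using u by (intro uniform_limitD) auto
    with ev show "\<forall>\<^sub>F F in finite_subsets_at_top A. dist (\<Sum>p\<in>F. cheb_coeff (g p) n) (cheb_coeff f n) < e"
    proof eventually_elim
      case (elim F)
      then have cs: "continuous_on {-1..1} (\<lambda>x. \<Sum>p\<in>F. g p x)"
        by (auto intro!: continuous_on_sum c)
      have "norm (cheb_coeff (\<lambda>x. (\<Sum>p\<in>F. g p x) - f x) n) \<le> 2 * (e / 3)"
        by (rule norm_cheb_coeff_le) (use elim cs cf in \<open>auto simp: dist_norm less_imp_le intro!: continuous_on_diff\<close>)
      also have "cheb_coeff (\<lambda>x. (\<Sum>p\<in>F. g p x) - f x) n = (\<Sum>p\<in>F. cheb_coeff (g p) n) - cheb_coeff f n"
        using elim cs cf by (subst cheb_coeff_diff) (auto simp: cheb_coeff_sum c subset_iff)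
      finally show ?case using e by (simp add: dist_norm)
    qed
  qed
qed

subsection \<open>Uniqueness and convergence of Chebyshev expansions\<close>

text \<open>Coefficient 0 is integration against the Chebyshev weight, up to the factor 1/pi.
  Vanishing coefficients make this integral of \<open>g\<close> times any polynomial zero, hence by
  Stone-Weierstrass of \<open>g\<close> times any continuous function. The conjugate of
  \<open>g\<close> as test function leaves the weighted integral of the squared modulus.\<close>

lemma cheb_coeff_all_0_imp_eq_0:
  assumes c: "continuous_on {-1..1} g" and 0: "\<And>n. cheb_coeff g n = 0" and x: "x \<in> {-1..1}"
  shows "g x = 0"
proof -
  \<comment> \<open>Multiplication by x = T_1 replaces T_n by the mean of T_(n+1) and T_|n-1|, so
    the induction on \<open>k\<close> has to treat all \<open>n\<close> at once.\<close>
  have mono: "cheb_coeff (\<lambda>x. g x * of_real (x ^ k) * of_real (cheb_T n x)) 0 = 0" for k n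
  proof (induction k arbitrary: n)
    case 0
    have ct: "continuous_on {-1..1} (\<lambda>x. g x * of_real (cheb_T n x))"
      by (intro continuous_intros c)
    show ?case
      using \<open>cheb_coeff g n = 0\<close>
      by (simp add: cheb_coeff_eq_cos_integral[OF c] cheb_coeff_eq_cos_integral[OF ct] cheb_T_cos
          split: if_splits)
  next
    case (Suc k)
    let ?f = "\<lambda>j x. g x * of_real (x ^ k) * of_real (cheb_T j x)"
    have cf: "continuous_on {-1..1} (?f j)" for j
      by (intro continuous_intros c)
    have "cheb_coeff (\<lambda>x. g x * of_real (x ^ Suc k) * of_real (cheb_T n x)) 0
        = cheb_coeff (\<lambda>x. (1 / 2) * (?f (1 + n) x + ?f (ndist 1 n) x)) 0"
    proof (rule cheb_coeff_cong)
      fix x :: real assume "x \<in> {-1..1}"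
      then have "complex_of_real x * of_real (cheb_T n x)
          = (1 / 2) * (of_real (cheb_T (1 + n) x) + of_real (cheb_T (ndist 1 n) x))"
        using of_real_cheb_T_mult[of x 1 n] by simp
      moreover have "g x * of_real (x ^ Suc k) * of_real (cheb_T n x)
          = g x * of_real (x ^ k) * (complex_of_real x * of_real (cheb_T n x))"
        by (simp add: mult_ac)
      ultimately show "g x * of_real (x ^ Suc k) * of_real (cheb_T n x)
          = (1 / 2) * (?f (1 + n) x + ?f (ndist 1 n) x)"
        by (simp only: distrib_left) (simp add: field_simps)
    qed
    also have "\<dots> = (1 / 2) * (cheb_coeff (?f (1 + n)) 0 + cheb_coeff (?f (ndist 1 n)) 0)"
      by (simp only: cheb_coeff_cmult cheb_coeff_add[OF cf cf])
    finally show ?case by (simp only: Suc.IH) simp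
  qed
  have poly: "cheb_coeff (\<lambda>x. g x * of_real (p x)) 0 = 0" if p: "real_polynomial_function p" for p
  proof -
    obtain a n where p_eq: "p = (\<lambda>x. \<Sum>i\<le>n. a i * x ^ i)"
      using p unfolding real_polynomial_function_iff_sum by blast
    have "cheb_coeff (\<lambda>x. g x * of_real (p x)) 0
        = cheb_coeff (\<lambda>x. \<Sum>i\<le>n. of_real (a i) * (g x * of_real (x ^ i) * of_real (cheb_T 0 x))) 0"
      by (simp add: p_eq sum_distrib_left mult_ac)
    also have "\<dots> = 0"
      by (subst cheb_coeff_sum) (auto simp: cheb_coeff_cmult mono simp del: cheb_T.simps of_real_power intro!: continuous_intros c)
    finally show ?thesis .
  qed
  have cont: "cheb_coeff (\<lambda>x. g x * of_real (h x)) 0 = 0" if h: "continuous_on {-1..1} h" for h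
  proof -
    have "compact (g ` {-1..1})" by (intro compact_continuous_image c) auto
    then obtain B where B: "B > 0" "\<And>x. x \<in> {-1..1} \<Longrightarrow> norm (g x) \<le> B"
      using compact_imp_bounded bounded_pos by (metis imageI)
    have "norm (cheb_coeff (\<lambda>x. g x * of_real (h x)) 0) \<le> 0 + e" if e: "e > 0" for e
    proof -
      \<comment> \<open>The accuracy compensates the bound \<open>B\<close> on \<open>g\<close> and
        the factor 2 of \<open>norm_cheb_coeff_le\<close>.\<close>
      obtain p where p: "real_polynomial_function p" "\<And>x. x \<in> {-1..1} \<Longrightarrow> \<bar>h x - p x\<bar> < e / (2 * B)"
        using Stone_Weierstrass_real_polynomial_function[of "{-1..1}" h "e / (2 * B)"] h B e by auto
      have cp: "continuous_on {-1..1} p"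
        using p(1) continuous_real_polymonial_function by (blast intro: continuous_at_imp_continuous_on)
      have "norm (cheb_coeff (\<lambda>x. g x * of_real (h x) - g x * of_real (p x)) 0) \<le> 2 * (B * (e / (2 * B)))"
      proof (rule norm_cheb_coeff_le)
        fix x :: real assume x: "x \<in> {-1..1}"
        have "g x * of_real (h x) - g x * of_real (p x) = g x * of_real (h x - p x)"
          by (simp add: right_diff_distrib)
        then show "norm (g x * of_real (h x) - g x * of_real (p x)) \<le> B * (e / (2 * B))"
          using B(2)[OF x] p(2)[OF x] B(1)
          by (simp only: norm_mult norm_of_real) (intro mult_mono; simp)
      qed (intro continuous_intros c h cp)
      also have "cheb_coeff (\<lambda>x. g x * of_real (h x) - g x * of_real (p x)) 0 = cheb_coeff (\<lambda>x. g x * of_real (h x)) 0"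
        by (subst cheb_coeff_diff) (auto simp: poly p(1) intro!: continuous_intros c h cp)
      finally show ?thesis using B by simp
    qed
    then have "norm (cheb_coeff (\<lambda>x. g x * of_real (h x)) 0) \<le> 0"
      by (rule field_le_epsilon)
    then show ?thesis by simp
  qed
  have cRe: "continuous_on {-1..1} (\<lambda>x. Re (g x))" and cIm: "continuous_on {-1..1} (\<lambda>x. Im (g x))"
    by (intro continuous_intros c)+
  \<comment> \<open>The test functions in \<open>cont\<close> are real, so the conjugate of
    \<open>g\<close> is split into its real and imaginary parts.\<close>
  have "cheb_coeff (\<lambda>x. of_real ((cmod (g x))\<^sup>2)) 0
      = cheb_coeff (\<lambda>x. g x * of_real (Re (g x)) + (- \<i>) * (g x * of_real (Im (g x)))) 0"
  proof (rule cheb_coeff_cong)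
    fix x
    have "of_real ((cmod (g x))\<^sup>2) = g x * cnj (g x)" by (rule complex_norm_square)
    also have "cnj (g x) = of_real (Re (g x)) + (- \<i>) * of_real (Im (g x))"
      by (simp add: complex_eq_iff)
    finally show "of_real ((cmod (g x))\<^sup>2) = g x * of_real (Re (g x)) + (- \<i>) * (g x * of_real (Im (g x)))"
      by (simp add: algebra_simps)
  qed
  also have "\<dots> = 0"
    by (subst cheb_coeff_add, (intro continuous_intros c)+, unfold cheb_coeff_cmult) (simp add: cont cRe cIm)
  finally have z: "cheb_coeff (\<lambda>x. of_real ((cmod (g x))\<^sup>2)) 0 = 0" .
  have cn: "continuous_on {-1..1} (\<lambda>x. complex_of_real ((cmod (g x))\<^sup>2))"
    by (intro continuous_intros c)
  have cn': "continuous_on {0..pi} (\<lambda>t. (cmod (g (cos t)))\<^sup>2)"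
    by (intro continuous_intros continuous_on_compose2[OF c]) auto
  have "complex_of_real (integral {0..pi} (\<lambda>t. (cmod (g (cos t)))\<^sup>2))
      = integral {0..pi} (\<lambda>t. complex_of_real ((cmod (g (cos t)))\<^sup>2))"
    by (subst integral_linear[OF _ bounded_linear_of_real, unfolded o_def])
      (auto intro!: integrable_continuous_real cn')
  also have "\<dots> = 0"
    using z unfolding cheb_coeff_eq_cos_integral[OF cn] by simp
  finally have "integral {0..pi} (\<lambda>t. (cmod (g (cos t)))\<^sup>2) = 0" by simp
  then have "\<forall>t\<in>{0..pi}. (cmod (g (cos t)))\<^sup>2 = 0"
    by (subst (asm) integral_eq_0_iff[OF cn']) auto
  then show "g x = 0"
    using x by (auto dest!: bspec[of _ _ "arccos x"] simp: arccos_lbound arccos_ubound)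
qed

text \<open>Absolute summability makes the series converge uniformly to a continuous function; by
  orthogonality this has the same coefficients as \<open>f\<close>, so uniqueness identifies the
  two.\<close>

lemma cheb_expansion:
  assumes c: "continuous_on {-1..1} f" and s: "(\<lambda>n. norm (cheb_coeff f n)) summable_on UNIV"
    and x: "x \<in> {-1..1}"
  shows "((\<lambda>n. cheb_coeff f n * of_real (cheb_T n x)) has_sum f x) UNIV"
proof -
  define S where "S = (\<lambda>x. \<Sum>\<^sub>\<infinity>n. cheb_coeff f n * of_real (cheb_T n x))"
  have le: "norm (cheb_coeff f n * of_real (cheb_T n y)) \<le> norm (cheb_coeff f n)" if "y \<in> {-1..1}" for n y
    using abs_cheb_T_le_1[OF that, of n] mult_left_mono[of "\<bar>cheb_T n y\<bar>" 1 "norm (cheb_coeff f n)"]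
    by (simp add: norm_mult)
  have S: "((\<lambda>n. cheb_coeff f n * of_real (cheb_T n y)) has_sum S y) UNIV" if "y \<in> {-1..1}" for y
    unfolding S_def
    by (intro has_sum_infsum abs_summable_summable[OF Infinite_Sum.abs_summable_on_comparison_test'[OF s]])
      (use le[OF that] in auto)
  have cT: "continuous_on {-1..1} (\<lambda>y. cheb_coeff f n * of_real (cheb_T n y))" for n
    by (intro continuous_intros)
  note hs = cheb_coeff_has_sum[where A = UNIV and g = "\<lambda>n y. cheb_coeff f n * of_real (cheb_T n y)" and f = S
      and M = "\<lambda>n. norm (cheb_coeff f n)", OF cT le s S]
  have cS: "continuous_on {-1..1} S" by (rule hs(1)) auto
  have "cheb_coeff (\<lambda>y. f y - S y) n = 0" for n
  proof -
    have "((\<lambda>m. cheb_coeff (\<lambda>y. cheb_coeff f m * of_real (cheb_T m y)) n) has_sum cheb_coeff S n) UNIV"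
      by (rule hs(2)) auto
    then have "((\<lambda>m. if m = n then cheb_coeff f n else 0) has_sum cheb_coeff S n) UNIV"
      by (rule has_sum_cong[THEN iffD1, rotated]) (auto simp: cheb_coeff_cmult cheb_coeff_cheb_T)
    moreover have "((\<lambda>m. if m = n then cheb_coeff f n else 0) has_sum cheb_coeff f n) UNIV"
      by (rule has_sum_finite_neutralI[of "{n}"]) auto
    ultimately have "cheb_coeff S n = cheb_coeff f n" by (rule has_sum_unique)
    then show ?thesis by (simp add: cheb_coeff_diff c cS)
  qed
  then have "f x - S x = 0"
    by (intro cheb_coeff_all_0_imp_eq_0[of "\<lambda>y. f y - S y"] continuous_intros c cS x)
  then show ?thesis using S[OF x] by simp
qed

subsection \<open>Decay of the coefficients of analytic functions\<close>

text \<open>The circle of radius \<open>r\<close> goes to a Bernstein ellipse, which therefore stays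
  in the \<open>r - 1\<close> neighbourhood of [-1,1]. The two parts of the displacement have sizes
  \<open>r - 1\<close> and \<open>1 - 1 / r\<close>, and the second is at most the first because
  \<open>(r - 1)\<^sup>2\<close> is nonnegative.\<close>

lemma dist_joukowski_le:
  assumes "r \<ge> 1"
  shows "dist ((of_real r * cis t + 1 / (of_real r * cis t)) / 2) (of_real (cos t)) \<le> r - 1"
proof -
  have inv: "1 / (of_real r * cis t) = of_real (1 / r) * cis (- t)"
    by (simp add: divide_inverse flip: cis_inverse)
  have d: "(of_real r * cis t + 1 / (of_real r * cis t)) / 2 - of_real (cos t)
      = (of_real (r - 1) * cis t - of_real (1 - 1 / r) * cis (- t)) / 2"
    unfolding inv by (simp add: complex_eq_iff algebra_simps)
  have "cmod (of_real (r - 1) * cis t - of_real (1 - 1 / r) * cis (- t)) \<le> (r - 1) + (1 - 1 / r)"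
    by (rule order_trans[OF norm_triangle_ineq4]) (use assms in \<open>simp add: norm_mult del: of_real_diff\<close>)
  moreover have "(r - 1) + (1 - 1 / r) \<le> 2 * (r - 1)"
    using assms zero_le_power2[of "r - 1"] by (simp add: field_simps power2_eq_square)
  ultimately show ?thesis unfolding dist_norm d norm_divide by simp
qed

text \<open>Under \<open>x = (z + 1/z) / 2\<close> the Chebyshev coefficients become Laurent coefficients, so the
  circle of integration can be moved outwards from \<open>\<bar>z\<bar> = 1\<close> to \<open>\<bar>z\<bar> = 1 + e\<close>.\<close>

lemma norm_cheb_coeff_holomorphic_le:
  assumes V: "open V" "f holomorphic_on V" and e: "e > 0"
    and M: "\<And>x w. x \<in> {-1..1} \<Longrightarrow> dist w (of_real x) \<le> e \<Longrightarrow> w \<in> V \<and> norm (f w) \<le> M"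
  shows "norm (cheb_coeff (\<lambda>x. f (of_real x)) n) \<le> 2 * M / (1 + e) ^ n"
proof -
  define J :: "complex \<Rightarrow> complex" where "J = (\<lambda>z. (z + 1 / z) / 2)"
  define S where "S = {z. z \<noteq> 0 \<and> J z \<in> V}"
  define F where "F = (\<lambda>z. f (J z) / z ^ (n + 1))"
  have near: "dist (J (of_real r * cis t)) (of_real (cos t)) \<le> e" if "1 \<le> r" "r \<le> 1 + e" for r t
    using dist_joukowski_le[OF that(1), of t] that(2) unfolding J_def by linarith
  have inS: "of_real r * cis t \<in> S" and Fle: "norm (f (J (of_real r * cis t))) \<le> M"
    if "1 \<le> r" "r \<le> 1 + e" for r t
    using M[OF _ near[OF that], of t] that by (auto simp: S_def)
  have inV: "complex_of_real x \<in> V" if "x \<in> {-1..1}" for x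
    using M[OF that, of "of_real x"] e by simp
  have holJ: "J holomorphic_on -{0}"
    unfolding J_def by (intro holomorphic_intros) auto
  have "S = -{0} \<inter> J -` V" by (auto simp: S_def)
  then have oS: "open S"
    using continuous_open_preimage[OF holomorphic_on_imp_continuous_on[OF holJ] _ V(1)] by auto
  have "f \<circ> J holomorphic_on S"
    by (rule holomorphic_on_compose_gen[OF holomorphic_on_subset[OF holJ] V(2)]) (auto simp: S_def)
  then have holF: "F holomorphic_on S"
    unfolding F_def o_def by (intro holomorphic_intros) (auto simp: S_def)
  let ?g = "\<lambda>r. part_circlepath 0 r (- pi) pi"
  have g: "?g r u = of_real r * cis (linepath (- pi) pi u)" for r u
    by (simp add: part_circlepath_def cis_conv_exp)
  \<comment> \<open>Points of the two circles with the same parameter have the same angle, so the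
    segment between them is radial and its radii stay between 1 and \<open>1 + e\<close>.\<close>
  have "homotopic_loops S (?g 1) (?g (1 + e))"
  proof (rule homotopic_loops_linear)
    fix u :: real
    show "closed_segment (?g 1 u) (?g (1 + e) u) \<subseteq> S"
    proof
      fix z assume "z \<in> closed_segment (?g 1 u) (?g (1 + e) u)"
      then obtain v where v: "0 \<le> v" "v \<le> 1" and z: "z = (1 - v) *\<^sub>R ?g 1 u + v *\<^sub>R ?g (1 + e) u"
        by (auto simp: in_segment)
      have "z = of_real (1 + v * e) * cis (linepath (- pi) pi u)"
        unfolding z g by (simp add: scaleR_conv_of_real algebra_simps)
      then show "z \<in> S"
        using v e mult_right_mono[of v 1 e] by (auto intro!: inS simp del: of_real_add of_real_mult)
    qed
  qed (auto simp: pathstart_def pathfinish_def g linepath_def complex_eq_iff)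
  then have move: "contour_integral (?g 1) F = contour_integral (?g (1 + e)) F"
    by (rule Cauchy_theorem_homotopic_loops[OF _ oS holF]) auto
  have bound: "norm (contour_integral (?g (1 + e)) F) \<le> (M / (1 + e) ^ (n + 1)) * (1 + e) * \<bar>pi - - pi\<bar>"
  proof (rule contour_integral_bound_part_circlepath)
    have "path_image (?g (1 + e)) \<subseteq> S"
      unfolding path_image_def using e by (auto simp: g intro!: inS simp del: of_real_add)
    then show "F contour_integrable_on ?g (1 + e)"
      by (intro contour_integrable_holomorphic_simple[OF holF oS]) auto
    have "0 \<le> M" using order_trans[OF norm_ge_zero Fle[of 1 0]] e by simp
    then show "0 \<le> M / (1 + e) ^ (n + 1)" using e by simp
    fix z assume "z \<in> path_image (?g (1 + e))"
    then obtain u where z: "z = of_real (1 + e) * cis (linepath (- pi) pi u)"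
      by (auto simp: path_image_def g simp del: of_real_add)
    have "norm z = 1 + e" unfolding z norm_mult norm_of_real using e by simp
    then show "norm (F z) \<le> M / (1 + e) ^ (n + 1)"
      unfolding F_def norm_divide norm_power using Fle[of "1 + e" "linepath (- pi) pi u"] e z
      by (auto intro!: divide_right_mono)
  qed (use e in auto)
  \<comment> \<open>On the unit circle dz is i z dt, which leaves the factor z^(-n). Since f(cos t)
    is even, folding t onto -t cancels the sine part and doubles the cosine part.\<close>
  have unit: "contour_integral (?g 1) F = 2 * \<i> * integral {0..pi} (\<lambda>t. f (of_real (cos t)) * of_real (cos (real n * t)))"
  proof -
    define h where "h = (\<lambda>t. f (of_real (cos t)) * cis (- (real n * t)))"
    have J_cis: "J (cis t) = of_real (cos t)" for t
      by (simp add: J_def complex_eq_iff flip: cis_inverse inverse_eq_divide)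
    have contf: "continuous_on UNIV (\<lambda>t. f (of_real (cos t)))"
      by (rule continuous_on_compose2[OF holomorphic_on_imp_continuous_on[OF V(2)]])
        (auto intro!: continuous_intros inV)
    have conth: "continuous_on A h" for A
      unfolding h_def using contf
      by (auto intro!: continuous_intros simp: cis_conv_exp intro: continuous_on_subset)
    have "contour_integral (?g 1) F = integral {-pi..pi} (\<lambda>t. F (0 + of_real 1 * cis t) * of_real 1 * \<i> * cis t)"
      by (rule contour_integral_part_circlepath_eq) simp
    also have "\<dots> = integral {-pi..pi} (\<lambda>t. \<i> * h t)"
    proof (rule integral_cong)
      fix t :: real
      have "cis t / cis t ^ (n + 1) = inverse (cis t ^ n)" by (simp add: field_simps)
      also have "\<dots> = cis (- (real n * t))" by (simp add: Complex.DeMoivre)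
      finally have "cis t / cis t ^ (n + 1) = cis (- (real n * t))" .
      then show "F (0 + of_real 1 * cis t) * of_real 1 * \<i> * cis t = \<i> * h t"
        by (simp add: F_def h_def J_cis field_simps)
    qed
    also have "\<dots> = \<i> * integral {-pi..pi} h" by (rule integral_mult_right)
    also have "integral {-pi..pi} h = integral {-pi..0} h + integral {0..pi} h"
      by (rule Henstock_Kurzweil_Integration.integral_combine[symmetric]) (auto intro!: integrable_continuous_real conth)
    also have "integral {-pi..0} h = integral {0..pi} (\<lambda>t. h (- t))"
      using Henstock_Kurzweil_Integration.integral_reflect_real[of pi 0 "\<lambda>t. h (- t)"] by simp
    also have "\<dots> + integral {0..pi} h = integral {0..pi} (\<lambda>t. h (- t) + h t)"
      by (rule Henstock_Kurzweil_Integration.integral_add[symmetric])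
        (auto intro!: integrable_continuous_real conth continuous_on_compose2[OF conth[of UNIV], of _ uminus] continuous_intros)
    also have "(\<lambda>t. h (- t) + h t) = (\<lambda>t. 2 * (f (of_real (cos t)) * of_real (cos (real n * t))))"
      by (auto simp: h_def fun_eq_iff complex_eq_iff algebra_simps)
    also have "integral {0..pi} \<dots> = 2 * integral {0..pi} (\<lambda>t. f (of_real (cos t)) * of_real (cos (real n * t)))"
      by (rule integral_mult_right)
    finally show ?thesis by (simp only: mult_ac)
  qed
  have "2 * norm (integral {0..pi} (\<lambda>t. f (of_real (cos t)) * of_real (cos (real n * t))))
      = norm (contour_integral (?g 1) F)"
    unfolding unit by (simp add: norm_mult)
  also have "\<dots> \<le> (M / (1 + e) ^ (n + 1)) * (1 + e) * \<bar>pi - - pi\<bar>"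
    unfolding move by (rule bound)
  also have "\<dots> = 2 * (M / (1 + e) ^ n * pi)"
  proof -
    have "(M / a ^ (n + 1)) * a * \<bar>pi - - pi\<bar> = 2 * (M / a ^ n * pi)" if "a > 0" for a :: real
      using that by (simp add: field_simps)
    then show ?thesis using e by simp
  qed
  finally have I: "norm (integral {0..pi} (\<lambda>t. f (of_real (cos t)) * of_real (cos (real n * t)))) \<le> M / (1 + e) ^ n * pi"
    by simp
  have cf: "continuous_on {-1..1} (\<lambda>x. f (of_real x))"
    by (rule continuous_on_compose2[OF holomorphic_on_imp_continuous_on[OF V(2)]])
      (auto intro!: continuous_intros inV)
  have "norm (cheb_coeff (\<lambda>x. f (of_real x)) n) \<le> (2 / pi) * (M / (1 + e) ^ n * pi)"
    unfolding cheb_coeff_eq_cos_integral[OF cf] norm_mult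
    by (intro mult_mono I) (auto simp: norm_divide divide_right_mono)
  then show ?thesis by simp
qed

section \<open>Slices of analytic functions of two variables\<close>

lemma analytic2_onE:
  assumes "analytic2_on f S"
  obtains U where "open U" "S \<subseteq> U"
    "\<And>z. z \<in> U \<Longrightarrow> \<exists>p q. ((\<lambda>w. f (fst w) (snd w)) has_derivative (\<lambda>h. p * fst h + q * snd h)) (at z)"
proof -
  from assms obtain U where U: "open U" "S \<subseteq> U" and D: "\<forall>z\<in>U. \<exists>p q. ((\<lambda>w. f (fst w) (snd w)) has_derivative (\<lambda>h. p * fst h + q * snd h)) (at z)"
    unfolding analytic2_on_def by (elim exE conjE)
  show ?thesis by (rule that[OF U bspec[OF D]])
qed

text \<open>Compactness of the square yields one radius \<open>e\<close> and one bound
  \<open>M\<close> valid for all slices in both directions. This uniformity is what lets the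
  one-variable estimate be applied with the other variable as a parameter.\<close>

lemma analytic2_on_slices:
  assumes "analytic2_on f (complex_of_real ` {-1..1} \<times> complex_of_real ` {-1..1})"
  obtains e M where "e > 0"
    "\<And>x. x \<in> {-1..1} \<Longrightarrow> \<exists>V. open V \<and> (\<lambda>w. f (of_real x) w) holomorphic_on V \<and>
       (\<forall>y\<in>{-1..1}. \<forall>w. dist w (of_real y) \<le> e \<longrightarrow> w \<in> V \<and> norm (f (of_real x) w) \<le> M)"
    "\<And>y. y \<in> {-1..1} \<Longrightarrow> \<exists>V. open V \<and> (\<lambda>w. f w (of_real y)) holomorphic_on V \<and>
       (\<forall>x\<in>{-1..1}. \<forall>w. dist w (of_real x) \<le> e \<longrightarrow> w \<in> V \<and> norm (f w (of_real y)) \<le> M)"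
    "continuous_on ({-1..1} \<times> {-1..1}) (\<lambda>(x, y). f (complex_of_real x) (complex_of_real y))"
proof -
  define Q where "Q = complex_of_real ` {-1..1} \<times> complex_of_real ` {-1..1}"
  obtain U where U: "open U" "Q \<subseteq> U" and
    D: "\<And>z. z \<in> U \<Longrightarrow> \<exists>p q. ((\<lambda>w. f (fst w) (snd w)) has_derivative (\<lambda>h. p * fst h + q * snd h)) (at z)"
    by (rule analytic2_onE[OF assms, folded Q_def]) (rule that)
  let ?f = "\<lambda>w. f (fst w) (snd w)"
  have contU: "continuous_on U ?f"
    by (rule continuous_at_imp_continuous_on) (use D has_derivative_continuous in blast)
  have cQ: "compact Q"
    unfolding Q_def by (intro compact_Times compact_continuous_image continuous_intros) auto
  obtain e where e: "e > 0" "(\<Union>z\<in>Q. cball z e) \<subseteq> U"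
    using compact_subset_open_imp_cball_epsilon_subset[OF cQ U] by blast
  \<comment> \<open>The closed \<open>e\<close>-neighbourhood of \<open>Q\<close>, written as a sum
    of compact sets so that its compactness is immediate.\<close>
  define N where "N = {z + h |z h. z \<in> Q \<and> h \<in> cball 0 e}"
  have NU: "N \<subseteq> U"
  proof
    fix z assume "z \<in> N"
    then obtain z' h where "z = z' + h" "z' \<in> Q" "h \<in> cball 0 e" by (auto simp: N_def)
    then have "z' \<in> Q" "z \<in> cball z' e" by (auto simp: dist_norm)
    then show "z \<in> U" using e(2) by blast
  qed
  have "compact N" unfolding N_def by (intro compact_sums cQ compact_cball)
  then have "compact (?f ` N)"
    by (intro compact_continuous_image continuous_on_subset[OF contU NU])
  then have "bounded (?f ` N)" by (rule compact_imp_bounded)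
  then obtain M where M: "\<And>z. z \<in> N \<Longrightarrow> norm (?f z) \<le> M"
    unfolding bounded_iff by blast
  have inN: "z \<in> N" if "z' \<in> Q" "dist z z' \<le> e" for z z'
  proof -
    have "z = z' + (z - z')" "z - z' \<in> cball 0 e"
      using that by (simp_all add: dist_norm norm_minus_commute)
    then show ?thesis unfolding N_def using that(1) by blast
  qed
  show ?thesis
  proof (rule that[OF e(1)])
    fix x :: real assume x: "x \<in> {-1..1}"
    define V where "V = {w. (complex_of_real x, w) \<in> U}"
    have "V = (\<lambda>w. (complex_of_real x, w)) -` U" by (auto simp: V_def)
    then have "open V"
      using U(1) by (auto intro!: open_vimage continuous_intros)
    moreover have "(\<lambda>w. f (of_real x) w) holomorphic_on V"
      unfolding holomorphic_on_def
    proof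
      fix w assume w: "w \<in> V"
      then obtain p q where pq: "(?f has_derivative (\<lambda>h. p * fst h + q * snd h)) (at (complex_of_real x, w))"
        using D unfolding V_def by blast
      have "((\<lambda>w. (complex_of_real x, w)) has_derivative (\<lambda>h. (0, h))) (at w)"
        by (auto intro!: derivative_eq_intros)
      from has_derivative_compose[OF this, where g = ?f and g' = "\<lambda>h. p * fst h + q * snd h"] pq
      have "((\<lambda>w. f (of_real x) w) has_derivative (\<lambda>h. q * h)) (at w)"
        by simp
      then show "(\<lambda>w. f (of_real x) w) field_differentiable at w within V"
        by (auto simp: field_differentiable_def has_field_derivative_def intro: has_derivative_at_withinI)
    qed
    moreover have "w \<in> V \<and> norm (f (of_real x) w) \<le> M" if "y \<in> {-1..1}" "dist w (of_real y) \<le> e" for y w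
    proof -
      have "(complex_of_real x, w) \<in> N"
        by (rule inN[of "(of_real x, of_real y)"]) (use that x in \<open>auto simp: Q_def dist_Pair_Pair\<close>)
      then show ?thesis using NU M[of "(complex_of_real x, w)"] by (auto simp: V_def)
    qed
    ultimately show "\<exists>V. open V \<and> (\<lambda>w. f (of_real x) w) holomorphic_on V \<and>
       (\<forall>y\<in>{-1..1}. \<forall>w. dist w (of_real y) \<le> e \<longrightarrow> w \<in> V \<and> norm (f (of_real x) w) \<le> M)"
      by blast
  next
    fix y :: real assume y: "y \<in> {-1..1}"
    define V where "V = {w. (w, complex_of_real y) \<in> U}"
    have "V = (\<lambda>w. (w, complex_of_real y)) -` U" by (auto simp: V_def)
    then have "open V"
      using U(1) by (auto intro!: open_vimage continuous_intros)
    moreover have "(\<lambda>w. f w (of_real y)) holomorphic_on V"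
      unfolding holomorphic_on_def
    proof
      fix w assume w: "w \<in> V"
      then obtain p q where pq: "(?f has_derivative (\<lambda>h. p * fst h + q * snd h)) (at (w, complex_of_real y))"
        using D unfolding V_def by blast
      have "((\<lambda>w. (w, complex_of_real y)) has_derivative (\<lambda>h. (h, 0))) (at w)"
        by (auto intro!: derivative_eq_intros)
      from has_derivative_compose[OF this, where g = ?f and g' = "\<lambda>h. p * fst h + q * snd h"] pq
      have "((\<lambda>w. f w (of_real y)) has_derivative (\<lambda>h. p * h)) (at w)"
        by simp
      then show "(\<lambda>w. f w (of_real y)) field_differentiable at w within V"
        by (auto simp: field_differentiable_def has_field_derivative_def intro: has_derivative_at_withinI)
    qed
    moreover have "w \<in> V \<and> norm (f w (of_real y)) \<le> M" if "x \<in> {-1..1}" "dist w (of_real x) \<le> e" for x w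
    proof -
      have "(w, complex_of_real y) \<in> N"
        by (rule inN[of "(of_real x, of_real y)"]) (use that y in \<open>auto simp: Q_def dist_Pair_Pair\<close>)
      then show ?thesis using NU M[of "(w, complex_of_real y)"] by (auto simp: V_def)
    qed
    ultimately show "\<exists>V. open V \<and> (\<lambda>w. f w (of_real y)) holomorphic_on V \<and>
       (\<forall>x\<in>{-1..1}. \<forall>w. dist w (of_real x) \<le> e \<longrightarrow> w \<in> V \<and> norm (f w (of_real y)) \<le> M)"
      by blast
  next
    have "continuous_on ({-1..1} \<times> {-1..1}) (\<lambda>z. ?f (complex_of_real (fst z), complex_of_real (snd z)))"
      by (rule continuous_on_compose2[OF contU]) (use U(2) in \<open>auto simp: Q_def intro!: continuous_intros\<close>)
    then show "continuous_on ({-1..1} \<times> {-1..1}) (\<lambda>(x, y). f (complex_of_real x) (complex_of_real y))"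
      by (simp add: case_prod_unfold)
  qed
qed

lemma continuous_on_slice:
  assumes "continuous_on (A \<times> B) (\<lambda>(x, y). K x y)" "x \<in> A"
  shows "continuous_on B (K x)"
proof -
  have "continuous_on B (\<lambda>y. (\<lambda>(x, y). K x y) (x, y))"
    by (rule continuous_on_compose2[OF assms(1)]) (use assms(2) in \<open>auto intro!: continuous_intros\<close>)
  then show ?thesis by simp
qed

lemma continuous_on_swap_args:
  assumes "continuous_on (A \<times> B) (\<lambda>(x, y). K x y)"
  shows "continuous_on (B \<times> A) (\<lambda>(y, x). K x y)"
proof -
  have "continuous_on (B \<times> A) (\<lambda>z. (\<lambda>(x, y). K x y) (snd z, fst z))"
    by (rule continuous_on_compose2[OF assms]) (auto intro!: continuous_intros)
  then show ?thesis by (simp add: case_prod_unfold)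
qed

text \<open>In the angle variable the integrand is continuous on a compact rectangle, so continuity
  in the parameter is standard; the original integrand carries the singular weight.\<close>

lemma continuous_on_cheb_coeff_param:
  fixes K :: "real \<Rightarrow> real \<Rightarrow> complex"
  assumes "continuous_on ({-1..1} \<times> {-1..1}) (\<lambda>(x, y). K x y)"
  shows "continuous_on {-1..1} (\<lambda>x. cheb_coeff (K x) n)"
proof -
  have c: "continuous_on {-1..1} (K x)" if "x \<in> {-1..1}" for x
    by (rule continuous_on_slice[OF assms that])
  have "continuous_on ({-1..1} \<times> cbox 0 pi) (\<lambda>z. (\<lambda>(x, y). K x y) (fst z, cos (snd z)) * of_real (cos (real n * snd z)))"
    by (intro continuous_intros continuous_on_compose2[OF assms]) (auto intro!: continuous_intros)
  then have "continuous_on {-1..1} (\<lambda>x. integral (cbox 0 pi) (\<lambda>t. K x (cos t) * of_real (cos (real n * t))))"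
    by (intro integral_continuous_on_param) (simp add: case_prod_unfold)
  then show ?thesis
    by (subst continuous_on_cong[OF refl cheb_coeff_eq_cos_integral[OF c]]) (auto intro!: continuous_intros)
qed

text \<open>Fubini for continuous functions, in the two angle variables. It makes the decay in
  \<open>m\<close> accessible, since the definition of \<open>cheb_coeff2\<close> integrates over
  \<open>y\<close> first.\<close>

lemma cheb_coeff2_swap:
  assumes "continuous_on ({-1..1} \<times> {-1..1}) (\<lambda>(x, y). K x y)"
  shows "cheb_coeff2 K m n = cheb_coeff2 (\<lambda>y x. K x y) n m"
proof -
  have assms': "continuous_on ({-1..1} \<times> {-1..1}) (\<lambda>(y, x). K x y)"
    by (rule continuous_on_swap_args[OF assms])
  have c: "continuous_on {-1..1} (K x)" "continuous_on {-1..1} (\<lambda>y. K y x)" if "x \<in> {-1..1}" for x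
    by (rule continuous_on_slice[OF assms that] continuous_on_slice[OF assms' that])+
  let ?c = "\<lambda>n. complex_of_real ((if n = 0 then 1 else 2) / pi)"
  let ?f = "\<lambda>s t. K (cos s) (cos t) * of_real (cos (real n * t)) * of_real (cos (real m * s))"
  have "continuous_on (cbox (0, 0) (pi, pi)) (\<lambda>z. (\<lambda>(x, y). K x y) (cos (fst z), cos (snd z))
      * of_real (cos (real n * snd z)) * of_real (cos (real m * fst z)))"
    by (intro continuous_intros continuous_on_compose2[OF assms]) (auto intro!: continuous_intros)
  then have sw: "integral (cbox 0 pi) (\<lambda>s. integral (cbox 0 pi) (?f s))
      = integral (cbox 0 pi) (\<lambda>t. integral (cbox 0 pi) (\<lambda>s. ?f s t))"
    by (intro integral_swap_continuous) (simp add: case_prod_unfold)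
  have "cheb_coeff2 K m n = ?c m * integral {0..pi} (\<lambda>s. (?c n * integral {0..pi} (\<lambda>t. K (cos s) (cos t) * of_real (cos (real n * t)))) * of_real (cos (real m * s)))"
    unfolding cheb_coeff2_def cheb_coeff_eq_cos_integral[OF continuous_on_cheb_coeff_param[OF assms]]
    by (simp add: cheb_coeff_eq_cos_integral c)
  also have "\<dots> = ?c m * (?c n * integral {0..pi} (\<lambda>s. integral {0..pi} (?f s)))"
    unfolding integral_mult_left mult.assoc[of "?c n"] integral_mult_right ..
  also have "\<dots> = ?c n * (?c m * integral {0..pi} (\<lambda>t. integral {0..pi} (\<lambda>s. ?f s t)))"
    using sw by (simp add: mult_ac)
  also have "\<dots> = ?c n * integral {0..pi} (\<lambda>t. (?c m * integral {0..pi} (\<lambda>s. K (cos s) (cos t) * of_real (cos (real m * s)))) * of_real (cos (real n * t)))"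
    unfolding mult.assoc[of "?c m"] integral_mult_right integral_mult_left[symmetric]
    by (simp add: mult_ac)
  also have "\<dots> = cheb_coeff2 (\<lambda>y x. K x y) n m"
    unfolding cheb_coeff2_def cheb_coeff_eq_cos_integral[OF continuous_on_cheb_coeff_param[OF assms']]
    by (simp add: cheb_coeff_eq_cos_integral c)
  finally show ?thesis .
qed

text \<open>Holomorphy in \<open>y\<close>, uniformly in \<open>x\<close>, gives decay in
  \<open>n\<close>; exchanging the variables gives decay in \<open>m\<close>. In each case the outer
  coefficient costs a further factor 2, hence \<open>4 * M\<close>.\<close>

lemma cheb_coeff2_decay:
  assumes "analytic2_on f (complex_of_real ` {-1..1} \<times> complex_of_real ` {-1..1})"
    and K_def: "K = (\<lambda>x y. f (complex_of_real x) (complex_of_real y))"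
  obtains C q where "0 < q" "q < 1" "\<And>m n. norm (cheb_coeff2 K m n) \<le> C * q ^ (m + n)"
    "\<And>x n. x \<in> {-1..1} \<Longrightarrow> norm (cheb_coeff (K x) n) \<le> C * q ^ n"
    "continuous_on ({-1..1} \<times> {-1..1}) (\<lambda>(x, y). K x y)"
proof -
  from analytic2_on_slices[OF assms(1)] obtain e M where e: "e > 0" and
    V1: "\<And>x. x \<in> {-1..1} \<Longrightarrow> \<exists>V. open V \<and> (\<lambda>w. f (of_real x) w) holomorphic_on V \<and>
       (\<forall>y\<in>{-1..1}. \<forall>w. dist w (of_real y) \<le> e \<longrightarrow> w \<in> V \<and> norm (f (of_real x) w) \<le> M)" and
    V2: "\<And>y. y \<in> {-1..1} \<Longrightarrow> \<exists>V. open V \<and> (\<lambda>w. f w (of_real y)) holomorphic_on V \<and>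
       (\<forall>x\<in>{-1..1}. \<forall>w. dist w (of_real x) \<le> e \<longrightarrow> w \<in> V \<and> norm (f w (of_real y)) \<le> M)" and
    cK: "continuous_on ({-1..1} \<times> {-1..1}) (\<lambda>(x, y). K x y)"
    unfolding K_def by blast
  have b1: "norm (cheb_coeff (K x) n) \<le> 2 * M / (1 + e) ^ n" if x: "x \<in> {-1..1}" for x n
  proof -
    obtain V where "open V" "(\<lambda>w. f (of_real x) w) holomorphic_on V"
      "\<forall>y\<in>{-1..1}. \<forall>w. dist w (of_real y) \<le> e \<longrightarrow> w \<in> V \<and> norm (f (of_real x) w) \<le> M"
      using V1[OF x] by blast
    then show ?thesis unfolding K_def by (intro norm_cheb_coeff_holomorphic_le[OF _ _ e]) auto
  qed
  have b2: "norm (cheb_coeff (\<lambda>x. K x y) n) \<le> 2 * M / (1 + e) ^ n" if y: "y \<in> {-1..1}" for y n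
  proof -
    obtain V where "open V" "(\<lambda>w. f w (of_real y)) holomorphic_on V"
      "\<forall>x\<in>{-1..1}. \<forall>w. dist w (of_real x) \<le> e \<longrightarrow> w \<in> V \<and> norm (f w (of_real y)) \<le> M"
      using V2[OF y] by blast
    then show ?thesis unfolding K_def by (intro norm_cheb_coeff_holomorphic_le[OF _ _ e]) auto
  qed
  have cK': "continuous_on ({-1..1} \<times> {-1..1}) (\<lambda>(y, x). K x y)"
    by (rule continuous_on_swap_args[OF cK])
  have n: "norm (cheb_coeff2 K m n) \<le> 2 * (2 * M / (1 + e) ^ n)" for m n
    unfolding cheb_coeff2_def by (intro norm_cheb_coeff_le continuous_on_cheb_coeff_param[OF cK] b1)
  have m: "norm (cheb_coeff2 K m n) \<le> 2 * (2 * M / (1 + e) ^ m)" for m n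
    by (subst cheb_coeff2_swap[OF cK], unfold cheb_coeff2_def) (intro norm_cheb_coeff_le continuous_on_cheb_coeff_param[OF cK'] b2)
  have M: "0 \<le> M" using order_trans[OF norm_ge_zero b1[of 0 0]] by simp
  \<comment> \<open>The better of the two bounds decays like (1 + e)^(-max m n), and 2 * max m n
    \<ge> m + n; the square root provides the half.\<close>
  define q where "q = sqrt (1 / (1 + e))"
  have q: "0 < q" "q < 1" using e by (auto simp: q_def)
  have qk: "1 / (1 + e) ^ k = q ^ (2 * k)" for k
    using e by (simp add: q_def power_mult power_one_over)
  show ?thesis
  proof (rule that[OF q, of "4 * M"])
    fix m n :: nat
    have "norm (cheb_coeff2 K m n) \<le> 4 * M * (1 / (1 + e) ^ max m n)"
      using m[of m n] n[of m n] by (auto simp: max_def)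
    also have "\<dots> \<le> 4 * M * q ^ (m + n)"
      unfolding qk using q M by (intro mult_left_mono power_decreasing) auto
    finally show "norm (cheb_coeff2 K m n) \<le> 4 * M * q ^ (m + n)" .
  next
    fix x :: real and n :: nat assume "x \<in> {-1..1}"
    then have "norm (cheb_coeff (K x) n) \<le> 2 * M * (1 / (1 + e) ^ n)" using b1 by simp
    also have "\<dots> \<le> 4 * M * q ^ n"
      unfolding qk using q M by (intro mult_mono power_decreasing) auto
    finally show "norm (cheb_coeff (K x) n) \<le> 4 * M * q ^ n" .
  qed (rule cK)
qed

section \<open>Geometric series and the double Chebyshev expansion\<close>

lemma has_sum_geometric:
  fixes t :: real
  assumes "0 \<le> t" "t < 1"
  shows "((\<lambda>d. t ^ d) has_sum (1 / (1 - t))) UNIV"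
  using assms by (intro sums_nonneg_imp_has_sum geometric_sums) auto

lemma has_sum_geometric_product:
  fixes q :: real
  assumes "0 \<le> q" "q < 1"
  shows "((\<lambda>(m, n). q ^ (m + n)) has_sum (1 / (1 - q))\<^sup>2) UNIV"
proof -
  have 1: "((\<lambda>n. q ^ m * q ^ n) has_sum (q ^ m * (1 / (1 - q)))) UNIV" for m
    by (rule has_sum_cmult_right[OF has_sum_geometric[OF assms]])
  have 2: "((\<lambda>m. q ^ m * (1 / (1 - q))) has_sum (1 / (1 - q)) * (1 / (1 - q))) UNIV"
    by (rule has_sum_cmult_left[OF has_sum_geometric[OF assms]])
  have "(\<lambda>(m, n). q ^ m * q ^ n) summable_on (UNIV \<times> UNIV)"
    using assms 1 by (intro summable_on_SigmaI[OF _ has_sum_imp_summable[OF 2]]) auto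
  then have "((\<lambda>(m, n). q ^ m * q ^ n) has_sum (1 / (1 - q)) * (1 / (1 - q))) (UNIV \<times> UNIV)"
    using 1 2 by (intro has_sum_SigmaI[where g = "\<lambda>m. q ^ m * (1 / (1 - q))"]) auto
  then show ?thesis by (simp add: power_add power2_eq_square)
qed

text \<open>Expand in \<open>y\<close> for fixed \<open>x\<close>, then each coefficient in
  \<open>x\<close>. Absolute summability merges the iterated sums into one unordered double
  sum.\<close>

lemma cheb_expansion2:
  assumes cK: "continuous_on ({-1..1} \<times> {-1..1}) (\<lambda>(x, y). K x y)"
    and q: "0 < q" "q < 1"
    and k: "\<And>m n. norm (cheb_coeff2 K m n) \<le> C * q ^ (m + n)"
    and k1: "\<And>x n. x \<in> {-1..1} \<Longrightarrow> norm (cheb_coeff (K x) n) \<le> C * q ^ n"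
    and x: "x \<in> {-1..1}" and y: "y \<in> {-1..1}"
  shows "((\<lambda>(m, n). cheb_coeff2 K m n * of_real (cheb_T m x) * of_real (cheb_T n y)) has_sum K x y) UNIV"
proof -
  have g: "(\<lambda>n. q ^ n) summable_on UNIV"
    using q by (intro summable_nonneg_imp_summable_on) auto
  let ?g = "\<lambda>m n. cheb_coeff2 K m n * of_real (cheb_T m x) * of_real (cheb_T n y)"
  have cx: "continuous_on {-1..1} (K x)"
    by (rule continuous_on_slice[OF cK x])
  have "(\<lambda>(m, n). C * q ^ (m + n)) summable_on UNIV"
    using summable_on_cmult_right[OF has_sum_imp_summable[OF has_sum_geometric_product[of q]], of C] q
    by (simp add: case_prod_unfold)
  then have "(\<lambda>p. norm (case p of (m, n) \<Rightarrow> ?g m n)) summable_on UNIV"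
  proof (rule Infinite_Sum.abs_summable_on_comparison_test')
    fix p :: "nat \<times> nat"
    obtain m n where p: "p = (m, n)" by (cases p)
    have "norm (?g m n) = norm (cheb_coeff2 K m n) * (\<bar>cheb_T m x\<bar> * \<bar>cheb_T n y\<bar>)"
      by (simp add: norm_mult)
    also have "\<dots> \<le> (C * q ^ (m + n)) * (1 * 1)"
      using order_trans[OF norm_ge_zero k]
      by (intro mult_mono k abs_cheb_T_le_1 x y) auto
    finally show "norm (case p of (m, n) \<Rightarrow> ?g m n) \<le> (case p of (m, n) \<Rightarrow> C * q ^ (m + n))"
      by (simp add: p)
  qed
  then have sm: "(\<lambda>(m, n). ?g m n) summable_on UNIV"
    by (rule abs_summable_summable)
  \<comment> \<open>In the iterated sum \<open>n\<close> is the outer index, so the pairs have to be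
    taken in the order (n, m).\<close>
  then have sm': "(\<lambda>(n, m). ?g m n) summable_on (UNIV \<times> UNIV)"
    using summable_on_swap[of "\<lambda>(m, n). ?g m n" UNIV UNIV] by (simp add: case_prod_unfold)
  have "(\<lambda>m. norm (cheb_coeff (\<lambda>x. cheb_coeff (K x) n) m)) summable_on UNIV" for n
    by (rule Infinite_Sum.abs_summable_on_comparison_test'[OF summable_on_cmult_right[OF g, of "C * q ^ n"]])
      (use k[of _ n] in \<open>simp add: cheb_coeff2_def power_add mult_ac\<close>)
  then have inner: "((\<lambda>m. cheb_coeff2 K m n * of_real (cheb_T m x)) has_sum cheb_coeff (K x) n) UNIV" for n
    unfolding cheb_coeff2_def by (intro cheb_expansion continuous_on_cheb_coeff_param cK x)
  have outer: "((\<lambda>n. cheb_coeff (K x) n * of_real (cheb_T n y)) has_sum K x y) UNIV"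
  proof (rule cheb_expansion[OF cx _ y])
    show "(\<lambda>n. norm (cheb_coeff (K x) n)) summable_on UNIV"
      by (rule Infinite_Sum.abs_summable_on_comparison_test'[OF summable_on_cmult_right[OF g, of C]])
        (use k1[OF x] in simp)
  qed
  have "((\<lambda>(n, m). ?g m n) has_sum K x y) (UNIV \<times> UNIV)"
    by (rule has_sum_SigmaI[OF _ outer sm']) (auto intro: has_sum_cmult_left inner)
  then show ?thesis
    using has_sum_swap[where f = "\<lambda>(m, n). ?g m n" and S = "K x y" and A = UNIV and B = UNIV] by (simp add: case_prod_unfold)
qed

subsection \<open>Compactness in weighted sequence spaces\<close>

text \<open>A Hilbert cube in the weighted coordinates once \<open>b\<close> is square summable;
  membership in \<open>wl2 lam\<close> then follows and is not built in.\<close>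

definition wl2_cube :: "real \<Rightarrow> (nat \<Rightarrow> real) \<Rightarrow> (nat \<Rightarrow> complex) set" where
  "wl2_cube lam b = {v. \<forall>k. cmod (v k) * (real k + 1) powr lam \<le> b k}"

lemma weight_term_eq:
  "(cmod z)\<^sup>2 * (real k + 1) powr (2 * lam) = (cmod z * (real k + 1) powr lam)\<^sup>2"
  by (simp add: power2_eq_square mult_ac flip: powr_add)

lemma wl2_cube_subset:
  assumes "(\<lambda>k. (b k)\<^sup>2) summable_on UNIV"
  shows "wl2_cube lam b \<subseteq> wl2 lam"
proof
  fix v assume v: "v \<in> wl2_cube lam b"
  have "(\<lambda>k. norm ((cmod (v k))\<^sup>2 * (real k + 1) powr (2 * lam))) summable_on UNIV"
    by (rule Infinite_Sum.abs_summable_on_comparison_test'[OF assms], unfold weight_term_eq)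
      (use v in \<open>auto simp: wl2_cube_def intro!: power_mono\<close>)
  then show "v \<in> wl2 lam" by (simp add: wl2_def)
qed

text \<open>Tychonoff gives compactness for coordinatewise convergence. Square summability of
  \<open>b\<close> dominates the squared differences, so that coordinatewise convergence inside the
  cube is already convergence in norm.\<close>

lemma compactin_wl2_cube:
  assumes b: "(\<lambda>k. (b k)\<^sup>2) summable_on UNIV"
  shows "compactin (wl2_topology lam) (wl2_cube lam b)"
proof -
  interpret Metric_space "wl2 lam" "wl2_dist lam" by (rule Metric_space_wl2)
  define w where "w = (\<lambda>k. (real k + 1) powr lam)"
  have w: "w k > 0" for k by (simp add: w_def)
  have w_eq: "(real k + 1) powr lam = w k" for k by (simp add: w_def)
  have "wl2_cube lam b = PiE UNIV (\<lambda>k. cball 0 (b k / w k))"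
    by (auto simp: wl2_cube_def PiE_def Pi_def w_eq pos_le_divide_eq w)
  moreover have "compactin (product_topology (\<lambda>_. euclidean) UNIV) (PiE UNIV (\<lambda>k. cball (0::complex) (b k / w k)))"
    by (simp add: compactin_PiE)
  ultimately have "compact (wl2_cube lam b)"
    by (simp add: euclidean_product_topology)
  then have sc: "seq_compact (wl2_cube lam b)" by (simp add: compact_imp_seq_compact)
  show ?thesis
    unfolding compactin_sequentially
  proof (intro conjI allI impI wl2_cube_subset b)
    fix \<sigma> :: "nat \<Rightarrow> nat \<Rightarrow> complex" assume \<sigma>: "range \<sigma> \<subseteq> wl2_cube lam b"
    then have "\<forall>n. \<sigma> n \<in> wl2_cube lam b" by auto
    then obtain l r where l: "l \<in> wl2_cube lam b" and r: "strict_mono (r :: nat \<Rightarrow> nat)"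
      and lim: "(\<sigma> \<circ> r) \<longlonglongrightarrow> l"
      by (rule seq_compactE[OF sc]) (rule that)
    have lim_k: "(\<lambda>n. \<sigma> (r n) k) \<longlonglongrightarrow> l k" for k
    proof -
      have "continuous_on UNIV (\<lambda>x :: nat \<Rightarrow> complex. x k)"
        by (rule continuous_on_product_coordinates)
      then have "isCont (\<lambda>x :: nat \<Rightarrow> complex. x k) l"
        using continuous_on_eq_continuous_at[OF open_UNIV] by blast
      from isCont_tendsto_compose[OF this lim] show ?thesis by simp
    qed
    define a where "a = (\<lambda>k n. (cmod (\<sigma> (r n) k - l k))\<^sup>2 * (real k + 1) powr (2 * lam))"
    have a_le: "norm (a k n) \<le> 4 * (b k)\<^sup>2" for k n
    proof -
      have "cmod (\<sigma> (r n) k - l k) * w k \<le> (cmod (\<sigma> (r n) k) + cmod (l k)) * w k"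
        using w[of k] by (intro mult_right_mono norm_triangle_ineq4) simp
      also have "\<dots> \<le> 2 * b k"
        using \<sigma> l by (auto simp: wl2_cube_def w_def distrib_right dest!: range_subsetD[of _ _ "r n"] spec[of _ k])
      finally have "(cmod (\<sigma> (r n) k - l k) * w k)\<^sup>2 \<le> (2 * b k)\<^sup>2"
        using w[of k] by (intro power_mono) auto
      then show ?thesis by (simp add: a_def weight_term_eq w_def power_mult_distrib)
    qed
    have sb: "(\<lambda>k. 4 * (b k)\<^sup>2) summable_on UNIV" using b by (rule summable_on_cmult_right)
    have sa: "(\<lambda>k. a k n) summable_on UNIV" for n
      using Infinite_Sum.abs_summable_on_comparison_test'[OF sb, of "\<lambda>k. a k n"] a_le
      by (auto intro: abs_summable_summable)
    \<comment> \<open>Dominated convergence for series, with majorant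
      \<open>4 * (b k)\<^sup>2\<close>.\<close>
    have "(\<lambda>n. suminf (\<lambda>k. a k n)) \<longlonglongrightarrow> suminf (\<lambda>k. 0)"
    proof (rule tannerys_theorem[THEN conjunct2, THEN conjunct2])
      show "(\<lambda>n. a k n) \<longlonglongrightarrow> 0" for k
      proof -
        have "(\<lambda>n. a k n) \<longlonglongrightarrow> (cmod (l k - l k))\<^sup>2 * (real k + 1) powr (2 * lam)"
          unfolding a_def by (intro tendsto_intros lim_k)
        then show ?thesis by simp
      qed
      show "summable (\<lambda>k. 4 * (b k)\<^sup>2)"
        using sb by (rule summable_on_imp_summable)
    qed (use a_le in \<open>auto intro!: always_eventually\<close>)
    moreover have "suminf (\<lambda>k. a k n) = (\<Sum>\<^sub>\<infinity>k. a k n)" for n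
      using has_sum_imp_sums[OF has_sum_infsum[OF sa]] by (simp add: sums_iff)
    ultimately have "(\<lambda>n. sqrt (\<Sum>\<^sub>\<infinity>k. a k n)) \<longlonglongrightarrow> sqrt 0"
      by (intro tendsto_real_sqrt) simp
    then have "(\<lambda>n. wl2_dist lam (\<sigma> (r n)) l) \<longlonglongrightarrow> 0"
      by (simp add: wl2_dist_def wl2_norm_def a_def)
    moreover have "\<sigma> (r n) \<in> wl2 lam" for n using \<sigma> wl2_cube_subset[OF b] by blast
    ultimately have "limitin mtopology (\<sigma> \<circ> r) l sequentially"
      unfolding limitin_metric_dist_null
      using wl2_cube_subset[OF b] l by (auto simp: o_def)
    with l r show "\<exists>l r. l \<in> wl2_cube lam b \<and> strict_mono r \<and> limitin mtopology (\<sigma> \<circ> r) l sequentially"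
      by blast
  qed
qed

section \<open>Matrices with exponential decay off the diagonal\<close>

lemma geometric_ndist:
  fixes t :: real
  assumes t: "0 \<le> t" "t < 1"
  shows "(\<lambda>j. t ^ ndist i j) summable_on UNIV" "(\<Sum>\<^sub>\<infinity>j. t ^ ndist i j) \<le> 2 / (1 - t)"
proof -
  have "((\<lambda>j. t ^ (j - i)) has_sum (1 / (1 - t))) {i..}"
    using has_sum_geometric[OF t]
    by (subst has_sum_reindex_bij_witness[of _ "\<lambda>d. d + i" "\<lambda>j. j - i" _ "\<lambda>d. t ^ d"]) auto
  then have 1: "((\<lambda>j. t ^ ndist i j) has_sum (1 / (1 - t))) {i..}"
    by (rule has_sum_cong[THEN iffD1, rotated]) (auto simp: ndist_def)
  have 2: "((\<lambda>j. t ^ ndist i j) has_sum (\<Sum>j<i. t ^ ndist i j)) {..<i}"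
    by (rule has_sum_finite) simp
  have "((\<lambda>j. t ^ ndist i j) has_sum ((\<Sum>j<i. t ^ ndist i j) + 1 / (1 - t))) ({..<i} \<union> {i..})"
    by (rule has_sum_Un_disjoint[OF 2 1]) auto
  moreover have "{..<i} \<union> {i..} = UNIV" by auto
  ultimately have 3: "((\<lambda>j. t ^ ndist i j) has_sum ((\<Sum>j<i. t ^ ndist i j) + 1 / (1 - t))) UNIV"
    by simp
  \<comment> \<open>One factor \<open>t\<close> is split off and then dropped, so that the left half
    becomes an initial segment of the geometric series read backwards; the bound is uniform in
    \<open>i\<close>.\<close>
  have "(\<Sum>j<i. t ^ ndist i j) = (\<Sum>j<i. t ^ Suc (i - Suc j))"
    by (intro sum.cong) (auto simp: ndist_def Suc_diff_Suc simp flip: power_Suc)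
  also have "\<dots> \<le> (\<Sum>j<i. t ^ (i - Suc j))"
    using t by (intro sum_mono) (auto simp: mult_left_le_one_le)
  also have "\<dots> = (\<Sum>j<i. t ^ j)" by (rule sum.nat_diff_reindex)
  also have "\<dots> \<le> 1 / (1 - t)"
    by (rule finite_sum_le_has_sum[OF has_sum_geometric[OF t]]) (use t in auto)
  finally show "(\<Sum>\<^sub>\<infinity>j. t ^ ndist i j) \<le> 2 / (1 - t)"
    using infsumI[OF 3] by simp
  show "(\<lambda>j. t ^ ndist i j) summable_on UNIV"
    using 3 by (rule has_sum_imp_summable)
qed

text \<open>A discrete Peetre inequality: i + 1 \<le> (j + 1)(1 + |i - j|), raised to the power
  \<open>lam\<close>, or with \<open>i\<close> and \<open>j\<close> exchanged to the power
  \<open>- lam\<close> when \<open>lam\<close> is negative.\<close>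

lemma weight_ratio:
  "(real i + 1) powr lam \<le> (real j + 1) powr lam * (1 + real (ndist i j)) powr \<bar>lam\<bar>"
proof -
  have *: "real i + 1 \<le> (real j + 1) * (1 + real (ndist i j))" for i j
  proof -
    have "i + 1 \<le> j + 1 + ndist i j" using ndist_le_iff[of i j "ndist i j"] by simp
    also have "\<dots> \<le> (j + 1) * (1 + ndist i j)" unfolding distrib_left by simp
    finally have "i + 1 \<le> (j + 1) * (1 + ndist i j)" .
    then have "real (i + 1) \<le> real ((j + 1) * (1 + ndist i j))" by (simp only: of_nat_le_iff)
    then show ?thesis by (simp only: of_nat_add of_nat_mult of_nat_1)
  qed
  show ?thesis
  proof (cases "lam \<ge> 0")
    case True
    then have "(real i + 1) powr lam \<le> ((real j + 1) * (1 + real (ndist i j))) powr lam"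
      by (intro powr_mono2 *) auto
    then show ?thesis using True by (simp add: powr_mult)
  next
    case False
    have "(real j + 1) powr (- lam) \<le> ((real i + 1) * (1 + real (ndist j i))) powr (- lam)"
      using False by (intro powr_mono2 *) auto
    also have "ndist j i = ndist i j" by (rule ndist_commute)
    finally have "(real j + 1) powr (- lam) \<le> (real i + 1) powr (- lam) * (1 + real (ndist i j)) powr (- lam)"
      by (simp add: powr_mult)
    then show ?thesis using False by (simp add: powr_minus field_simps)
  qed
qed

lemma powr_geometric_bounded:
  fixes t a :: real
  assumes "0 < t" "t < 1"
  obtains E where "\<And>d::nat. (1 + real d) powr a * t ^ d \<le> E"
proof -
  define c where "c = - ln t"
  have c: "c > 0" using assms by (simp add: c_def)
  \<comment> \<open>Chosen so that in ln y \<le> y - 1, taken at y = \<delta>(1 + d), the linear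
    growth multiplied by \<open>\<bar>a\<bar>\<close> stays below the decay rate \<open>c\<close> of
    \<open>t ^ d\<close>.\<close>
  define \<delta> where "\<delta> = c / (\<bar>a\<bar> + 1)"
  have \<delta>: "\<delta> > 0" "\<bar>a\<bar> * \<delta> \<le> c"
    using c by (simp_all add: \<delta>_def field_simps)
  show ?thesis
  proof (rule that)
    fix d :: nat
    have "ln (\<delta> * (1 + real d)) \<le> \<delta> * (1 + real d) - 1"
      using \<delta> by (intro ln_le_minus_one mult_pos_pos) auto
    then have "ln (1 + real d) \<le> \<delta> * (1 + real d) - 1 - ln \<delta>"
      using \<delta> by (simp add: ln_mult)
    then have "\<bar>a\<bar> * ln (1 + real d) \<le> \<bar>a\<bar> * (\<delta> * (1 + real d) - 1 - ln \<delta>)"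
      by (rule mult_left_mono) simp
    also have "\<dots> = (\<bar>a\<bar> * \<delta>) * (1 + real d) - \<bar>a\<bar> * (1 + ln \<delta>)"
      by (simp add: algebra_simps)
    also have "\<dots> \<le> c * (1 + real d) - \<bar>a\<bar> * (1 + ln \<delta>)"
      using \<delta> by (intro diff_right_mono mult_right_mono) auto
    finally have "\<bar>a\<bar> * ln (1 + real d) - c * real d \<le> c - \<bar>a\<bar> * (1 + ln \<delta>)"
      by (simp add: algebra_simps)
    moreover have "a * ln (1 + real d) \<le> \<bar>a\<bar> * ln (1 + real d)"
      by (intro mult_right_mono) auto
    ultimately have "a * ln (1 + real d) - c * real d \<le> c - \<bar>a\<bar> * (1 + ln \<delta>)" by linarith
    moreover have "(1 + real d) powr a * t ^ d = exp (a * ln (1 + real d) - c * real d)"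
      using assms by (simp add: powr_def c_def exp_add exp_of_nat_mult mult.commute[of _ "real d"])
    ultimately show "(1 + real d) powr a * t ^ d \<le> exp (c - \<bar>a\<bar> * (1 + ln \<delta>))" by simp
  qed
qed

text \<open>The decay is halved as \<open>s = t * t\<close>: one factor \<open>t ^ ndist i j\<close>
  absorbs the polynomial loss of \<open>weight_ratio\<close>, the other makes the sum over
  \<open>j\<close> converge. Of \<open>u\<close> only the bound of each weighted coordinate by the
  norm enters; the factor \<open>1 / (i + 1)\<close> is carried through.\<close>

lemma mat_app_bound:
  assumes s: "0 < s" "s < 1" and M: "\<And>i j. cmod (M i j) \<le> C * s ^ ndist i j / (real i + 1)"
  obtains D where "\<And>u i. u \<in> wl2 lam \<Longrightarrow> (\<lambda>j. M i j * u j) summable_on UNIV"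
    "\<And>u i. u \<in> wl2 lam \<Longrightarrow> cmod (mat_app M u i) * (real i + 1) powr lam \<le> D * wl2_norm lam u / (real i + 1)"
proof -
  define w where "w = (\<lambda>k. (real k + 1) powr lam)"
  have w: "w k > 0" for k by (simp add: w_def)
  have w_eq: "w k = (real k + 1) powr lam" for k by (simp add: w_def)
  define t where "t = sqrt s"
  have t: "0 < t" "t < 1" and st: "s = t * t" using s by (auto simp: t_def)
  obtain E where E: "\<And>d::nat. (1 + real d) powr \<bar>lam\<bar> * t ^ d \<le> E"
    using powr_geometric_bounded[OF t] by blast
  have C: "0 \<le> C" using M[of 0 0] norm_ge_zero[of "M 0 0"] by (simp del: norm_ge_zero)
  have E0: "0 \<le> E" using E[of 0] by simp
  have key: "cmod (M i j * u j) * w i \<le> (C * E * wl2_norm lam u / (real i + 1)) * t ^ ndist i j"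
    if u: "u \<in> wl2 lam" for u i j
  proof -
    have "(\<Sum>k\<in>{j}. (cmod (u k))\<^sup>2 * (real k + 1) powr (2 * lam)) \<le> (wl2_norm lam u)\<^sup>2"
      using u unfolding wl2_norm_def
      by (subst real_sqrt_pow2, intro infsum_nonneg, simp, intro finite_sum_le_infsum) (auto simp: wl2_def)
    then have "(cmod (u j) * w j)\<^sup>2 \<le> (wl2_norm lam u)\<^sup>2" by (simp add: weight_term_eq w_def)
    then have uj: "cmod (u j) * w j \<le> wl2_norm lam u"
      by (rule power2_le_imp_le) (auto simp: wl2_norm_def intro!: infsum_nonneg)
    have "cmod (M i j * u j) * w i \<le> (C * s ^ ndist i j / (real i + 1)) * cmod (u j) * (w j * (1 + real (ndist i j)) powr \<bar>lam\<bar>)"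
      unfolding norm_mult
      by (rule mult_mono[OF mult_right_mono[OF M norm_ge_zero] weight_ratio[of i lam j, folded w_eq]
            mult_nonneg_nonneg[OF _ norm_ge_zero] less_imp_le[OF w]])
        (use C s in simp)
    also have "\<dots> = (C * t ^ ndist i j / (real i + 1)) * ((1 + real (ndist i j)) powr \<bar>lam\<bar> * t ^ ndist i j) * (cmod (u j) * w j)"
      by (simp add: st power_mult_distrib mult_ac)
    also have "\<dots> \<le> (C * t ^ ndist i j / (real i + 1)) * E * wl2_norm lam u"
    proof (rule mult_mono[OF mult_left_mono[OF E] uj])
      show B: "0 \<le> C * t ^ ndist i j / (real i + 1)" using C t by simp
      then show "0 \<le> C * t ^ ndist i j / (real i + 1) * E" using E0 by (rule mult_nonneg_nonneg)
      show "0 \<le> cmod (u j) * w j" using w[of j] by simp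
    qed
    finally show ?thesis by (simp add: mult_ac)
  qed
  have key': "cmod (M i j * u j) \<le> (C * E * wl2_norm lam u / (real i + 1) / w i) * t ^ ndist i j"
    if u: "u \<in> wl2 lam" for u i j
    using key[OF u, of i j] w[of i] by (simp add: pos_le_divide_eq mult_ac)
  note gs = geometric_ndist[OF less_imp_le[OF t(1)] t(2)]
  have sm: "(\<lambda>j. (C * E * wl2_norm lam u / (real i + 1) / w i) * t ^ ndist i j) summable_on UNIV" for u i
    by (intro summable_on_cmult_right gs)
  show ?thesis
  proof (rule that[of "C * E * (2 / (1 - t))"])
    fix u i assume u: "u \<in> wl2 lam"
    show su: "(\<lambda>j. M i j * u j) summable_on UNIV"
      by (rule abs_summable_summable, rule Infinite_Sum.abs_summable_on_comparison_test'[OF sm[where u = u and i = i]])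
        (rule key'[OF u])
    have "cmod (mat_app M u i) \<le> (\<Sum>\<^sub>\<infinity>j. (C * E * wl2_norm lam u / (real i + 1) / w i) * t ^ ndist i j)"
      unfolding mat_app_def
      by (rule norm_infsum_le[OF has_sum_infsum[OF su] has_sum_infsum[OF sm]]) (rule key'[OF u])
    also have "\<dots> = (C * E * wl2_norm lam u / (real i + 1) / w i) * (\<Sum>\<^sub>\<infinity>j. t ^ ndist i j)"
      by (rule infsum_cmult_right) (use gs in auto)
    also have "\<dots> \<le> (C * E * wl2_norm lam u / (real i + 1) / w i) * (2 / (1 - t))"
      using C E0 w[of i]
      by (intro mult_left_mono gs divide_nonneg_pos mult_nonneg_nonneg) (auto simp: wl2_norm_def intro!: infsum_nonneg)
    also have "\<dots> = C * E * (2 / (1 - t)) * wl2_norm lam u / (real i + 1) / w i"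
      by (simp add: mult_ac)
    finally have "cmod (mat_app M u i) * w i \<le> C * E * (2 / (1 - t)) * wl2_norm lam u / (real i + 1)"
      by (simp only: pos_le_divide_eq[OF w])
    then show "cmod (mat_app M u i) * (real i + 1) powr lam
        \<le> C * E * (2 / (1 - t)) * wl2_norm lam u / (real i + 1)"
      by (simp only: w_def)
  qed
qed

lemma summable_on_inverse_squares: "(\<lambda>k::nat. (c / (real k + 1))\<^sup>2) summable_on UNIV"
proof -
  have "summable (\<lambda>k. inverse (real (Suc k) ^ 2))"
    by (subst summable_Suc_iff) (rule inverse_power_summable, simp)
  then have "summable (\<lambda>k. c\<^sup>2 * inverse (real (Suc k) ^ 2))" by (rule summable_mult)
  then have "summable (\<lambda>k. (c / (real k + 1))\<^sup>2)"
    by (simp add: power_mult_distrib power_inverse divide_inverse add.commute)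
  then show ?thesis by (intro summable_nonneg_imp_summable_on) auto
qed

text \<open>The image of the unit ball lies in a compact cube. In a metric space this cube is
  closed, so it contains the closure of the image as a closed subset.\<close>

lemma compact_on_wl2I:
  assumes "0 < s" "s < 1" "\<And>i j. cmod (M i j) \<le> C * s ^ ndist i j / (real i + 1)"
  shows "compact_on_wl2 M lam"
proof -
  interpret Metric_space "wl2 lam" "wl2_dist lam" by (rule Metric_space_wl2)
  from mat_app_bound[OF assms, of lam] obtain D where
    sm: "\<And>u i. u \<in> wl2 lam \<Longrightarrow> (\<lambda>j. M i j * u j) summable_on UNIV" and
    D: "\<And>u i. u \<in> wl2 lam \<Longrightarrow> cmod (mat_app M u i) * (real i + 1) powr lam \<le> D * wl2_norm lam u / (real i + 1)"
    by blast
  \<comment> \<open>A cube whose size depends on \<open>u\<close> covers every \<open>u\<close>, not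
    only the unit ball, as \<open>maps_wl2\<close> requires.\<close>
  have in_cube: "mat_app M u \<in> wl2_cube lam (\<lambda>i. D * wl2_norm lam u / (real i + 1))" if "u \<in> wl2 lam" for u
    using D[OF that] by (simp add: wl2_cube_def)
  have maps: "maps_wl2 M lam lam"
    unfolding maps_wl2_def
    using sm in_cube wl2_cube_subset[OF summable_on_inverse_squares] by blast
  \<comment> \<open>The absolute value is taken because \<open>mat_app_bound\<close> leaves the sign
    of \<open>D\<close> open.\<close>
  have "D * wl2_norm lam u / (real i + 1) \<le> \<bar>D\<bar> / (real i + 1)" if "wl2_norm lam u \<le> 1" for u i
  proof -
    have "0 \<le> wl2_norm lam u" by (auto simp: wl2_norm_def intro!: infsum_nonneg)
    then have "D * wl2_norm lam u \<le> \<bar>D\<bar> * 1" using that by (intro mult_mono) auto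
    then show ?thesis by (intro divide_right_mono) auto
  qed
  then have "mat_app M ` {u \<in> wl2 lam. wl2_norm lam u \<le> 1} \<subseteq> wl2_cube lam (\<lambda>i. \<bar>D\<bar> / (real i + 1))"
    unfolding wl2_cube_def using order_trans[OF D] by blast
  moreover have cpt: "compactin mtopology (wl2_cube lam (\<lambda>i. \<bar>D\<bar> / (real i + 1)))"
    by (intro compactin_wl2_cube summable_on_inverse_squares)
  ultimately have "mtopology closure_of (mat_app M ` {u \<in> wl2 lam. wl2_norm lam u \<le> 1})
      \<subseteq> wl2_cube lam (\<lambda>i. \<bar>D\<bar> / (real i + 1))"
    by (intro closure_of_minimal compactin_imp_closedin Hausdorff_space_mtopology)
  then show ?thesis
    unfolding compact_on_wl2_def using maps closed_compactin[OF cpt] by auto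
qed

lemma maps_wl2_R_mat: "maps_wl2 R_mat lam (lam - 1)"
  unfolding maps_wl2_def
proof (intro ballI conjI allI)
  fix u i assume u: "u \<in> wl2 lam"
  let ?r = "\<lambda>k. 2 * (if k = 0 then 1 / of_real (ln 2) else of_nat k) :: complex"
  have R: "((\<lambda>j. R_mat i j * u j) has_sum (?r i * u i)) UNIV" for i
    by (rule has_sum_finite_neutralI[of "{i}"]) (auto simp: R_mat_def diag_mat_def)
  then show "(\<lambda>j. R_mat i j * u j) summable_on UNIV" by (rule has_sum_imp_summable)
  have app: "mat_app R_mat u = (\<lambda>i. ?r i * u i)"
    unfolding mat_app_def using infsumI[OF R] by auto
  \<comment> \<open>The constant 3 is dictated by the entry at 0, where 2 / ln 2 lies just below
    3.\<close>
  have r: "cmod (?r k) \<le> 3 * (real k + 1)" for k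
  proof (cases "k = 0")
    case True
    have "2 / ln 2 \<le> (3 :: real)" using ln2_ge_two_thirds by (simp add: field_simps)
    then show ?thesis using True by (simp add: norm_mult norm_divide)
  qed (simp add: norm_mult)
  have "(\<lambda>k. 9 * ((cmod (u k))\<^sup>2 * (real k + 1) powr (2 * lam))) summable_on UNIV"
    using u unfolding wl2_def by (intro summable_on_cmult_right) simp
  then have "(\<lambda>k. norm ((cmod (?r k * u k))\<^sup>2 * (real k + 1) powr (2 * (lam - 1)))) summable_on UNIV"
  proof (rule Infinite_Sum.abs_summable_on_comparison_test')
    fix k
    have "cmod (?r k * u k) * (real k + 1) powr (lam - 1) \<le> (3 * (real k + 1)) * cmod (u k) * (real k + 1) powr (lam - 1)"
      unfolding norm_mult using r[of k] by (intro mult_right_mono) (auto simp: norm_mult)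
    also have "\<dots> = 3 * (cmod (u k) * (real k + 1) powr lam)"
      by (simp add: powr_diff field_simps)
    finally have "(cmod (?r k * u k) * (real k + 1) powr (lam - 1))\<^sup>2 \<le> (3 * (cmod (u k) * (real k + 1) powr lam))\<^sup>2"
      by (intro power_mono) auto
    then show "norm ((cmod (?r k * u k))\<^sup>2 * (real k + 1) powr (2 * (lam - 1)))
        \<le> 9 * ((cmod (u k))\<^sup>2 * (real k + 1) powr (2 * lam))"
      unfolding weight_term_eq by (simp add: power_mult_distrib)
  qed
  then show "mat_app R_mat u \<in> wl2 (lam - 1)"
    unfolding app wl2_def by simp
qed

subsection \<open>The matrix entries\<close>

text \<open>A sum of two indicators, not a disjunction: for \<open>n = 0\<close> or
  \<open>j = 0\<close> the two positions coincide and the halves must add up to 1.\<close>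

definition chebT_entry :: "nat \<Rightarrow> inf_mat" where
  "chebT_entry n i j = ((if i = n + j then 1 else 0) + (if i = ndist n j then 1 else 0)) / 2"

lemma mult_mat_cheb_T: "mult_mat (\<lambda>x. of_real (cheb_T n x)) i j = chebT_entry n i j"
proof -
  let ?T = "\<lambda>k x. complex_of_real (cheb_T k x)"
  have c: "continuous_on {-1..1} (?T k)" for k by (intro continuous_intros)
  have "mult_mat (?T n) i j = cheb_coeff (\<lambda>x. (1 / 2) * (?T (n + j) x + ?T (ndist n j) x)) i"
    unfolding mult_mat_def
  proof (rule cheb_coeff_cong)
    fix x :: real assume "x \<in> {-1..1}"
    then show "?T n x * ?T j x = (1 / 2) * (?T (n + j) x + ?T (ndist n j) x)"
      by (rule of_real_cheb_T_mult)
  qed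
  also have "\<dots> = (1 / 2) * (cheb_coeff (?T (n + j)) i + cheb_coeff (?T (ndist n j)) i)"
    by (simp only: cheb_coeff_cmult cheb_coeff_add[OF c c])
  also have "\<dots> = chebT_entry n i j"
    by (simp only: cheb_coeff_cheb_T chebT_entry_def) simp
  finally show ?thesis .
qed

lemma mult_mat_cmult: "mult_mat (\<lambda>x. c * a x) i j = c * mult_mat a i j"
  by (simp add: mult_mat_def mult.assoc cheb_coeff_cmult)

lemma mat_mult_diag_right: "(M \<otimes>\<^sub>M diag_mat d) i j = M i j * d j"
proof -
  have "((\<lambda>k. M i k * diag_mat d k j) has_sum (M i j * d j)) UNIV"
    by (rule has_sum_finite_neutralI[of "{j}"]) (auto simp: diag_mat_def)
  then show ?thesis by (simp add: mat_mult_def infsumI)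
qed

text \<open>A column of the multiplication matrix has at most two nonzero entries, so the infinite
  sum in the product is finite and raises no convergence question.\<close>

lemma mat_mult_cheb_T_right:
  "(M \<otimes>\<^sub>M mult_mat (\<lambda>x. of_real (cheb_T n x))) i j = (M i (n + j) + M i (ndist n j)) / 2"
proof -
  have s: "((\<lambda>k. M i k * (if k = a then 1 else 0)) has_sum M i a) UNIV" for a
    by (rule has_sum_finite_neutralI[of "{a}"]) auto
  have "((\<lambda>k. (M i k * (if k = n + j then 1 else 0) + M i k * (if k = ndist n j then 1 else 0)) * (1 / 2))
      has_sum ((M i (n + j) + M i (ndist n j)) * (1 / 2))) UNIV"
    by (intro has_sum_cmult_left has_sum_add s)
  also have "(\<lambda>k. (M i k * (if k = n + j then 1 else 0) + M i k * (if k = ndist n j then 1 else 0)) * (1 / 2))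
      = (\<lambda>k. M i k * chebT_entry n k j)"
    by (simp only: chebT_entry_def fun_eq_iff) (simp add: algebra_simps)
  finally show ?thesis by (simp add: mat_mult_def mult_mat_cheb_T infsumI)
qed

text \<open>The entries of \<open>M\<^sub>0[T\<^sub>m] diag(d) M\<^sub>0[T\<^sub>n]\<close>.\<close>

definition sandwich :: "(nat \<Rightarrow> complex) \<Rightarrow> nat \<Rightarrow> nat \<Rightarrow> inf_mat" where
  "sandwich d m n i j = (chebT_entry m i (n + j) * d (n + j) + chebT_entry m i (ndist n j) * d (ndist n j)) / 2"

lemma kernel_mat_diag_eq:
  "kernel_mat (diag_mat d) K i j = (\<Sum>\<^sub>\<infinity>(m, n). cheb_coeff2 K m n * sandwich d m n i j)"
  unfolding kernel_mat_def mat_mult_cheb_T_right mat_mult_diag_right mult_mat_cmult mult_mat_cheb_T sandwich_def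
  by (simp add: algebra_simps add_divide_distrib)

lemma norm_chebT_entry_le: "cmod (chebT_entry m i p) \<le> 1"
  by (simp add: chebT_entry_def norm_divide)

text \<open>Bandedness of width \<open>m\<close>. This is how decay in the degrees \<open>m\<close>
  and \<open>n\<close> becomes decay away from the diagonal.\<close>

lemma chebT_entry_nonzero:
  assumes "chebT_entry m i p \<noteq> 0"
  shows "i \<le> p + m" "p \<le> i + m"
proof -
  have "i = m + p \<or> i = ndist m p"
    using assms by (auto simp: chebT_entry_def split: if_splits)
  then have "ndist i p \<le> m"
    using ndist_ndist_le[of m p] by (auto simp: ndist_le_iff)
  then show "i \<le> p + m" "p \<le> i + m" by (simp_all add: ndist_le_iff)
qed

text \<open>With the identity in the middle, the sandwich is multiplication by T_m T_n. This links
  the commuted terms to the values of the kernel on the diagonal.\<close>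

lemma cheb_coeff_mult_cheb_T3:
  "cheb_coeff (\<lambda>x. of_real (cheb_T m x) * of_real (cheb_T n x) * of_real (cheb_T j x)) i = sandwich (\<lambda>_. 1) m n i j"
proof -
  let ?T = "\<lambda>k x. complex_of_real (cheb_T k x)"
  have c: "continuous_on {-1..1} (\<lambda>x. ?T m x * ?T k x)" for k by (intro continuous_intros)
  have "cheb_coeff (\<lambda>x. ?T m x * ?T n x * ?T j x) i
      = cheb_coeff (\<lambda>x. (1 / 2) * (?T m x * ?T (n + j) x + ?T m x * ?T (ndist n j) x)) i"
  proof (rule cheb_coeff_cong)
    fix x :: real assume "x \<in> {-1..1}"
    then have "?T n x * ?T j x = (1 / 2) * (?T (n + j) x + ?T (ndist n j) x)"
      by (rule of_real_cheb_T_mult)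
    then show "?T m x * ?T n x * ?T j x = (1 / 2) * (?T m x * ?T (n + j) x + ?T m x * ?T (ndist n j) x)"
      by (simp only: mult.assoc) (simp add: algebra_simps)
  qed
  also have "\<dots> = (1 / 2) * (mult_mat (?T m) i (n + j) + mult_mat (?T m) i (ndist n j))"
    unfolding mult_mat_def by (simp only: cheb_coeff_cmult cheb_coeff_add[OF c c])
  finally show ?thesis by (simp add: mult_mat_cheb_T sandwich_def)
qed

section \<open>The diagonals of \<open>log_mat\<close> and \<open>R_mat\<close> and their near
  cancellation\<close>

text \<open>Real-valued versions of the two diagonals, open to real inequalities. Their product is
  -2 at every index; the entry 1 / ln 2 of \<open>R_eigen\<close> achieves this at 0.\<close>

definition log_eigen :: "nat \<Rightarrow> real" where
  "log_eigen k = (if k = 0 then - ln 2 else - 1 / real k)"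

definition R_eigen :: "nat \<Rightarrow> real" where
  "R_eigen k = 2 * (if k = 0 then 1 / ln 2 else real k)"

lemma log_mat_eq: "log_mat = diag_mat (\<lambda>k. of_real (log_eigen k))"
  unfolding log_mat_def log_eigen_def by (intro arg_cong[of _ _ diag_mat]) auto

lemma R_mat_eq: "R_mat = diag_mat (\<lambda>k. of_real (R_eigen k))"
  unfolding R_mat_def R_eigen_def by (intro arg_cong[of _ _ diag_mat]) auto

lemma two_div_ln2_le: "2 / ln 2 \<le> (3 :: real)"
  using ln2_ge_two_thirds by (simp add: field_simps)

lemma abs_log_eigen_le: "\<bar>log_eigen k\<bar> \<le> 1"
  using ln2_le_25_over_36 by (auto simp: log_eigen_def)

lemma R_eigen_bounds: "0 \<le> R_eigen k" "R_eigen k \<le> 3 * (real k + 1)"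
  using two_div_ln2_le by (auto simp: R_eigen_def)

text \<open>For nearby indices \<open>p\<close> and \<open>j\<close> the product is almost \<open>log_eigen j * R_eigen j = - 2\<close>;
  the gain of a factor \<open>1 / (p + 1)\<close> is the source of compactness.\<close>

lemma log_R_eigen_bound:
  assumes "ndist p j \<le> n"
  shows "\<bar>log_eigen p * R_eigen j + 2\<bar> \<le> 4 * (real n + 1) / (real p + 1)"
proof -
  have n: "real p \<le> real j + real n" "real j \<le> real p + real n" using assms by (simp_all add: ndist_le_iff)
  \<comment> \<open>Index 0 carries exceptional entries. If exactly one index is 0, the other is at
    most \<open>n\<close>, and crude bounds suffice.\<close>
  consider "p = 0" "j = 0" | "p = 0" "j > 0" | "p > 0" "j = 0" | "p > 0" "j > 0" by auto
  then show ?thesis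
  proof cases
    case 1
    then show ?thesis by (simp add: log_eigen_def R_eigen_def)
  next
    case 2
    have "real j * ln 2 \<le> real j * 1" "0 \<le> real j * ln 2"
      using ln2_le_25_over_36 by (intro mult_left_mono) auto
    moreover have "\<bar>2 - 2 * y\<bar> \<le> 4 * (real n + 1)" if "0 \<le> y" "y \<le> real j * 1" for y
      using that n 2 by simp
    ultimately have "\<bar>2 - 2 * (real j * ln 2)\<bar> \<le> 4 * (real n + 1)" by blast
    then show ?thesis using 2 by (simp add: log_eigen_def R_eigen_def mult_ac)
  next
    case 3
    have "2 / ln 2 / real p \<le> 3 / 1"
      using 3 two_div_ln2_le by (intro frac_le) auto
    moreover have "0 \<le> 2 / ln 2 / real p" by simp
    moreover have "log_eigen p * R_eigen j + 2 = 2 - 2 / ln 2 / real p"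
      using 3 by (simp add: log_eigen_def R_eigen_def)
    ultimately have "\<bar>log_eigen p * R_eigen j + 2\<bar> \<le> 4" by linarith
    also have "4 \<le> 4 * (real n + 1) / (real p + 1)" using 3 n by (simp add: field_simps)
    finally show ?thesis .
  next
    case 4
    then have "log_eigen p * R_eigen j + 2 = 2 * (real p - real j) / real p"
      by (simp add: log_eigen_def R_eigen_def field_simps)
    then have "\<bar>log_eigen p * R_eigen j + 2\<bar> = 2 * \<bar>real p - real j\<bar> / real p"
      by (simp only: abs_mult abs_divide abs_numeral abs_of_nat)
    also have "\<dots> \<le> 2 * (real n + 1) / real p"
      using n by (intro divide_right_mono mult_left_mono) auto
    \<comment> \<open>For p \<ge> 1 one has p + 1 \<le> 2 p; this doubling turns the constant 2 into
      4.\<close>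
    also have "\<dots> \<le> 4 * (real n + 1) / (real p + 1)"
    proof -
      have "2 * (real n + 1) * (real p + 1) \<le> 2 * (real n + 1) * (2 * real p)"
        using 4 by (intro mult_left_mono) auto
      then show ?thesis using 4 by (simp add: field_simps)
    qed
    finally show ?thesis .
  qed
qed

lemma norm_sandwich_le:
  assumes "\<And>k. cmod (d k) \<le> 1"
  shows "cmod (sandwich d m n i j) \<le> 1"
proof -
  have *: "cmod (chebT_entry m i p * d p) \<le> 1" for p
    unfolding norm_mult using norm_chebT_entry_le assms by (intro mult_le_one) auto
  show ?thesis
    unfolding sandwich_def norm_divide using norm_triangle_le[OF add_mono[OF * *]] by simp
qed

text \<open>Adding twice the plain sandwich subtracts the commuted term, whose diagonal product is
  -2. The middle index p is within \<open>n\<close> of \<open>j\<close> and within \<open>m\<close>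
  of \<open>i\<close>; the latter gives i + 1 \<le> (m + 1)(p + 1), which trades the gain 1 / (p +
  1) for one in \<open>i\<close>.\<close>

lemma sandwich_log_bound:
  defines "c \<equiv> \<lambda>m n i j. sandwich (\<lambda>k. of_real (log_eigen k)) m n i j * of_real (R_eigen j)
      + 2 * sandwich (\<lambda>_. 1) m n i j"
  shows "cmod (c m n i j) \<le> 4 * (real m + 1) * (real n + 1) / (real i + 1)"
    and "c m n i j \<noteq> 0 \<Longrightarrow> ndist i j \<le> m + n"
proof -
  let ?e = "\<lambda>p. chebT_entry m i p * of_real (log_eigen p * R_eigen j + 2)"
  have c: "c m n i j = (?e (n + j) + ?e (ndist n j)) / 2"
    by (simp add: c_def sandwich_def field_simps)
  have e: "cmod (?e p) \<le> 4 * (real m + 1) * (real n + 1) / (real i + 1)" if p: "ndist p j \<le> n" for p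
  proof (cases "chebT_entry m i p = 0")
    case False
    have "i \<le> p + m" by (rule chebT_entry_nonzero[OF False])
    then have "real i + 1 \<le> real p + real m + 1" by simp
    also have "\<dots> \<le> (real m + 1) * (real p + 1)" by (simp add: algebra_simps)
    finally have ip: "1 / (real p + 1) \<le> (real m + 1) / (real i + 1)" by (simp add: field_simps)
    have "cmod (?e p) \<le> 1 * (4 * (real n + 1) / (real p + 1))"
      unfolding norm_mult norm_of_real
      by (intro mult_mono norm_chebT_entry_le log_R_eigen_bound p) auto
    also have "\<dots> = 4 * (real n + 1) * (1 / (real p + 1))" by simp
    also have "\<dots> \<le> 4 * (real n + 1) * ((real m + 1) / (real i + 1))"
      by (intro mult_left_mono ip) auto
    also have "\<dots> = 4 * (real m + 1) * (real n + 1) / (real i + 1)"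
      by (simp only: times_divide_eq_right mult_ac)
    finally show ?thesis .
  qed simp
  have "cmod (?e (n + j) + ?e (ndist n j)) \<le> 2 * (4 * (real m + 1) * (real n + 1) / (real i + 1))"
    unfolding mult_2
    by (intro norm_triangle_le add_mono e ndist_ndist_le) (simp add: ndist_le_iff)
  then show "cmod (c m n i j) \<le> 4 * (real m + 1) * (real n + 1) / (real i + 1)"
    unfolding c norm_divide by simp
  assume "c m n i j \<noteq> 0"
  then have "chebT_entry m i (n + j) \<noteq> 0 \<or> chebT_entry m i (ndist n j) \<noteq> 0"
    unfolding c by auto
  then obtain p where p: "chebT_entry m i p \<noteq> 0" "p = n + j \<or> p = ndist n j" by blast
  have "i \<le> p + m" "p \<le> i + m" by (rule chebT_entry_nonzero[OF p(1)])+
  moreover have "ndist p j \<le> n" using p(2) ndist_ndist_le[of n j] by (auto simp: ndist_le_iff)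
  ultimately show "ndist i j \<le> m + n" unfolding ndist_le_iff by linarith
qed

section \<open>Summation over the double expansion\<close>

text \<open>With \<open>t\<close> the cube root of \<open>q\<close>, one third of the decay absorbs
  the polynomial factors. Of the two remaining powers one will become decay in
  \<open>ndist i j\<close>, the other will make the sum over \<open>m\<close> and \<open>n\<close>
  converge.\<close>

lemma geometric_weight_bounds:
  fixes q :: real
  assumes q: "0 < q" "q < 1"
  obtains t E where "0 < t" "t < 1" "0 \<le> E"
    "\<And>m n. q ^ (m + n) * ((real m + 1) * (real n + 1)) \<le> E * (t ^ (m + n) * t ^ (m + n))"
proof -
  define t where "t = root 3 q"
  have t: "0 < t" "t < 1" and qt: "q = t ^ 3" using q by (auto simp: t_def)
  obtain E where E: "\<And>d::nat. (1 + real d) powr 1 * t ^ d \<le> E"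
    using powr_geometric_bounded[OF t, of 1] by blast
  have E': "(real d + 1) * t ^ d \<le> E" for d using E[of d] by (simp add: add.commute)
  have E0: "0 \<le> E" using E[of 0] by simp
  show ?thesis
  proof (rule that[OF t, of "E * E"])
    fix m n :: nat
    have "q ^ (m + n) * ((real m + 1) * (real n + 1))
        = (t ^ (m + n) * t ^ (m + n)) * (((real m + 1) * t ^ m) * ((real n + 1) * t ^ n))"
      by (simp add: qt power3_eq_cube power_mult_distrib power_add mult_ac)
    also have "\<dots> \<le> (t ^ (m + n) * t ^ (m + n)) * (E * E)"
      using t E0 by (intro mult_left_mono mult_mono E') auto
    finally show "q ^ (m + n) * ((real m + 1) * (real n + 1)) \<le> E * E * (t ^ (m + n) * t ^ (m + n))"
      by (simp add: mult_ac)
  qed (use E0 in simp)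
qed

lemma summable_on_cheb_coeff2_mult:
  assumes q: "0 < q" "q < 1" and k: "\<And>m n. cmod (cheb_coeff2 K m n) \<le> C * q ^ (m + n)"
    and b: "\<And>m n. cmod (b m n) \<le> 1"
  shows "(\<lambda>(m, n). cheb_coeff2 K m n * b m n) summable_on UNIV"
proof -
  have "(\<lambda>p. C * (case p of (m, n) \<Rightarrow> q ^ (m + n))) summable_on UNIV"
    using has_sum_imp_summable[OF has_sum_geometric_product[of q]] q by (intro summable_on_cmult_right) auto
  then have "(\<lambda>p. cmod (case p of (m, n) \<Rightarrow> cheb_coeff2 K m n * b m n)) summable_on UNIV"
  proof (rule Infinite_Sum.abs_summable_on_comparison_test')
    fix p :: "nat \<times> nat"
    have "cmod (cheb_coeff2 K m n * b m n) \<le> (C * q ^ (m + n)) * 1" for m n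
      unfolding norm_mult using order_trans[OF norm_ge_zero k] by (intro mult_mono k b) auto
    then show "cmod (case p of (m, n) \<Rightarrow> cheb_coeff2 K m n * b m n) \<le> C * (case p of (m, n) \<Rightarrow> q ^ (m + n))"
      by (auto split: prod.split)
  qed
  then show ?thesis by (rule abs_summable_summable)
qed

text \<open>The double expansion restricted to x = y converges uniformly, also after multiplication
  by T_j, so coefficients may be taken term by term.\<close>

lemma diagonal_sum:
  assumes cK: "continuous_on ({-1..1} \<times> {-1..1}) (\<lambda>(x, y). K x y)"
    and q: "0 < q" "q < 1"
    and k: "\<And>m n. cmod (cheb_coeff2 K m n) \<le> C * q ^ (m + n)"
    and k1: "\<And>x n. x \<in> {-1..1} \<Longrightarrow> cmod (cheb_coeff (K x) n) \<le> C * q ^ n"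
  shows "((\<lambda>(m, n). cheb_coeff2 K m n * sandwich (\<lambda>_. 1) m n i j) has_sum mult_mat (\<lambda>x. K x x) i j) UNIV"
proof -
  let ?g = "\<lambda>(m, n) x. cheb_coeff2 K m n * (complex_of_real (cheb_T m x) * of_real (cheb_T n x) * of_real (cheb_T j x))"
  have "((\<lambda>p. cheb_coeff (?g p) i) has_sum cheb_coeff (\<lambda>x. K x x * of_real (cheb_T j x)) i) UNIV"
  proof (rule cheb_coeff_has_sum(2))
    show "continuous_on {-1..1} (?g p)" for p
      by (cases p) (auto intro!: continuous_intros)
    show "(\<lambda>p. C * (case p of (m, n) \<Rightarrow> q ^ (m + n))) summable_on UNIV"
      using has_sum_imp_summable[OF has_sum_geometric_product[of q]] q by (intro summable_on_cmult_right) auto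
    fix x :: real assume x: "x \<in> {-1..1}"
    show "cmod (?g p x) \<le> C * (case p of (m, n) \<Rightarrow> q ^ (m + n))" for p
    proof (cases p)
      case (Pair m n)
      have "cmod (cheb_coeff2 K m n) * (\<bar>cheb_T m x\<bar> * \<bar>cheb_T n x\<bar> * \<bar>cheb_T j x\<bar>) \<le> (C * q ^ (m + n)) * (1 * 1 * 1)"
        using order_trans[OF norm_ge_zero k] by (intro mult_mono k abs_cheb_T_le_1 x) auto
      then show ?thesis by (simp add: Pair norm_mult)
    qed
    have "((\<lambda>p. (case p of (m, n) \<Rightarrow> cheb_coeff2 K m n * of_real (cheb_T m x) * of_real (cheb_T n x)) * of_real (cheb_T j x))
        has_sum K x x * of_real (cheb_T j x)) UNIV"
      by (rule has_sum_cmult_left[OF cheb_expansion2[OF cK q k k1 x x]])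
    then show "((\<lambda>p. ?g p x) has_sum K x x * of_real (cheb_T j x)) UNIV"
      by (simp add: case_prod_unfold mult_ac)
  qed
  then show ?thesis
    by (simp add: mult_mat_def case_prod_unfold cheb_coeff_cmult cheb_coeff_mult_cheb_T3)
qed

lemma log_kernel_perturbation:
  assumes cK: "continuous_on ({-1..1} \<times> {-1..1}) (\<lambda>(x, y). K x y)"
    and q: "0 < q" "q < 1"
    and k: "\<And>m n. cmod (cheb_coeff2 K m n) \<le> C * q ^ (m + n)"
    and k1: "\<And>x n. x \<in> {-1..1} \<Longrightarrow> cmod (cheb_coeff (K x) n) \<le> C * q ^ n"
    and diag: "\<And>x. x \<in> {-1..1} \<Longrightarrow> K x x = - 1 / 2"
    and t: "0 < t" "t < 1" and E: "0 \<le> E"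
    and qt: "\<And>m n. q ^ (m + n) * ((real m + 1) * (real n + 1)) \<le> E * (t ^ (m + n) * t ^ (m + n))"
  obtains D where "\<And>i j. cmod (log_kernel_mat K i j * of_real (R_eigen j) - (if i = j then 1 else 0))
    \<le> D * t ^ ndist i j / (real i + 1)"
proof (rule that[of "4 * C * E * (1 / (1 - t))\<^sup>2"])
  fix i j :: nat
  have C: "0 \<le> C" using order_trans[OF norm_ge_zero k[of 0 0]] by simp
  let ?l = "\<lambda>k. complex_of_real (log_eigen k)"
  let ?c = "\<lambda>m n. sandwich ?l m n i j * of_real (R_eigen j) + 2 * sandwich (\<lambda>_. 1) m n i j"
  have "mult_mat (\<lambda>x. K x x) i j = mult_mat (\<lambda>x. (- 1 / 2) * 1) i j"
    unfolding mult_mat_def by (rule cheb_coeff_cong) (simp add: diag)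
  also have "\<dots> = (- 1 / 2) * (if i = j then 1 else 0)"
    unfolding mult_mat_cmult by (simp add: mult_mat_def cheb_coeff_cheb_T)
  finally have d: "((\<lambda>(m, n). cheb_coeff2 K m n * sandwich (\<lambda>_. 1) m n i j) has_sum ((- 1 / 2) * (if i = j then 1 else 0))) UNIV"
    using diagonal_sum[OF cK q k k1, of i j] by simp
  have "(\<lambda>(m, n). cheb_coeff2 K m n * sandwich ?l m n i j) summable_on UNIV"
    by (intro summable_on_cheb_coeff2_mult[OF q k] norm_sandwich_le) (simp add: abs_log_eigen_le)
  then have "((\<lambda>(m, n). cheb_coeff2 K m n * sandwich ?l m n i j) has_sum log_kernel_mat K i j) UNIV"
    unfolding log_kernel_mat_def log_mat_eq kernel_mat_diag_eq by (rule has_sum_infsum)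
  \<comment> \<open>Twice the diagonal series sums to minus the identity entry, so the combined
    series represents the perturbation itself.\<close>
  from has_sum_add[OF has_sum_cmult_left[OF this, of "of_real (R_eigen j)"] has_sum_cmult_right[OF d, of 2]]
  have s: "((\<lambda>(m, n). cheb_coeff2 K m n * ?c m n) has_sum
      (log_kernel_mat K i j * of_real (R_eigen j) - (if i = j then 1 else 0))) UNIV"
    by (simp add: case_prod_unfold algebra_simps split: if_splits)
  \<comment> \<open>Majorant: 4 comes from \<open>sandwich_log_bound\<close>, \<open>E\<close> from
    exchanging \<open>q\<close> with polynomial factors for \<open>t\<close>, and the double
    geometric series contributes the square.\<close>
  have b: "((\<lambda>p. (4 * C * E * t ^ ndist i j / (real i + 1)) * (case p of (m, n) \<Rightarrow> t ^ (m + n))) has_sum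
      (4 * C * E * t ^ ndist i j / (real i + 1)) * (1 / (1 - t))\<^sup>2) UNIV"
    using t by (intro has_sum_cmult_right has_sum_geometric_product) auto
  have "cmod (cheb_coeff2 K m n * ?c m n) \<le> (4 * C * E * t ^ ndist i j / (real i + 1)) * t ^ (m + n)" for m n
  proof (cases "?c m n = 0")
    case True
    then show ?thesis using C E t by simp
  next
    case False
    have "cmod (cheb_coeff2 K m n * ?c m n) \<le> (C * q ^ (m + n)) * (4 * (real m + 1) * (real n + 1) / (real i + 1))"
      unfolding norm_mult[of "cheb_coeff2 K m n"]
      using C q by (intro mult_mono k sandwich_log_bound) auto
    also have "\<dots> = (4 * C / (real i + 1)) * (q ^ (m + n) * ((real m + 1) * (real n + 1)))"
      by (simp add: mult_ac)
    also have "\<dots> \<le> (4 * C / (real i + 1)) * (E * (t ^ (m + n) * t ^ (m + n)))"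
      by (rule mult_left_mono[OF qt]) (use C in simp)
    \<comment> \<open>A nonzero term has \<open>ndist i j \<le> m + n\<close>, so one of the two
      powers may be replaced.\<close>
    also have "\<dots> \<le> (4 * C / (real i + 1)) * (E * (t ^ ndist i j * t ^ (m + n)))"
      using C E t sandwich_log_bound(2)[OF False]
      by (intro mult_left_mono mult_right_mono power_decreasing) auto
    finally show ?thesis by (simp add: mult_ac)
  qed
  then have "cmod (case p of (m, n) \<Rightarrow> cheb_coeff2 K m n * ?c m n)
      \<le> (4 * C * E * t ^ ndist i j / (real i + 1)) * (case p of (m, n) \<Rightarrow> t ^ (m + n))" for p
    by (cases p) simp
  from norm_infsum_le[OF s b this]
  show "cmod (log_kernel_mat K i j * of_real (R_eigen j) - (if i = j then 1 else 0))
      \<le> 4 * C * E * (1 / (1 - t))\<^sup>2 * t ^ ndist i j / (real i + 1)"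
    by (simp add: mult_ac)
qed

text \<open>The middle matrix sees only index 0, which leaves the single term \<open>m = i\<close>,
  \<open>n = j\<close>. The entry is therefore the coefficient itself, halved for
  \<open>j > 0\<close>, and decays in \<open>i + j\<close>.\<close>

lemma sum_kernel_bound:
  assumes q: "0 < q" "q < 1"
    and k: "\<And>m n. cmod (cheb_coeff2 K m n) \<le> C * q ^ (m + n)"
    and t: "0 < t" "t < 1" and E: "0 \<le> E"
    and qt: "\<And>m n. q ^ (m + n) * ((real m + 1) * (real n + 1)) \<le> E * (t ^ (m + n) * t ^ (m + n))"
  obtains D where "\<And>i j. cmod (sum_kernel_mat K i j * of_real (R_eigen j)) \<le> D * t ^ ndist i j / (real i + 1)"
proof (rule that[of "3 * C * E"])
  fix i j :: nat
  have C: "0 \<le> C" using order_trans[OF norm_ge_zero k[of 0 0]] by simp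
  let ?d = "\<lambda>k. if k = 0 then 1 else 0 :: complex"
  have nz: "m = i \<and> n = j" if "sandwich ?d m n i j \<noteq> 0" for m n
  proof -
    have *: "(P \<and> a \<noteq> 0) \<or> (Q \<and> b \<noteq> 0)"
      if "(a * (if P then 1 else 0) + b * (if Q then 1 else 0)) / 2 \<noteq> 0" for a b :: complex and P Q
      using that by (auto split: if_splits)
    have "n + j = 0 \<and> chebT_entry m i (n + j) \<noteq> 0 \<or> ndist n j = 0 \<and> chebT_entry m i (ndist n j) \<noteq> 0"
      by (rule *[OF that[unfolded sandwich_def]])
    then have "n = j" and e: "chebT_entry m i 0 \<noteq> 0" by auto
    moreover have "m = i" using e by (auto simp: chebT_entry_def split: if_splits)
    ultimately show ?thesis by simp
  qed
  have "((\<lambda>(m, n). cheb_coeff2 K m n * sandwich ?d m n i j) has_sum (cheb_coeff2 K i j * sandwich ?d i j i j)) UNIV"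
    by (rule has_sum_finite_neutralI[of "{(i, j)}"]) (auto dest: nz)
  then have "sum_kernel_mat K i j = cheb_coeff2 K i j * sandwich ?d i j i j"
    unfolding sum_kernel_mat_def sum_mat_def kernel_mat_diag_eq by (rule infsumI)
  moreover have "cmod (cheb_coeff2 K i j * sandwich ?d i j i j) \<le> (C * q ^ (i + j)) * 1"
    unfolding norm_mult using C q by (intro mult_mono k norm_sandwich_le) auto
  ultimately have "cmod (sum_kernel_mat K i j * of_real (R_eigen j)) \<le> ((C * q ^ (i + j)) * 1) * (3 * (real j + 1))"
    unfolding norm_mult[of "sum_kernel_mat K i j"] norm_of_real abs_of_nonneg[OF R_eigen_bounds(1)]
    by (intro mult_mono R_eigen_bounds) (use C q in simp_all)
  \<comment> \<open>The factor \<open>1 / (real i + 1)\<close> is produced by expansion of the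
    fraction; the exponential decay pays for the numerator and for the growth of
    \<open>R_eigen\<close>.\<close>
  also have "\<dots> = (3 * C / (real i + 1)) * (q ^ (i + j) * ((real i + 1) * (real j + 1)))"
    by (simp add: field_simps)
  also have "\<dots> \<le> (3 * C / (real i + 1)) * (E * (t ^ (i + j) * t ^ (i + j)))"
    by (rule mult_left_mono[OF qt]) (use C in simp)
  also have "\<dots> \<le> (3 * C / (real i + 1)) * (E * (t ^ ndist i j * 1))"
    using C E t by (intro mult_left_mono mult_mono power_decreasing power_le_one ndist_le_add) auto
  finally show "cmod (sum_kernel_mat K i j * of_real (R_eigen j)) \<le> 3 * C * E * t ^ ndist i j / (real i + 1)"
    by simp
qed

lemma analytic2_on_cmult:
  assumes "analytic2_on f S"
  shows "analytic2_on (\<lambda>x y. c * f x y) S"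
proof -
  obtain U where U: "open U" "S \<subseteq> U" and
    D: "\<And>z. z \<in> U \<Longrightarrow> \<exists>p q. ((\<lambda>w. f (fst w) (snd w)) has_derivative (\<lambda>h. p * fst h + q * snd h)) (at z)"
    by (rule analytic2_onE[OF assms]) (rule that)
  have "\<exists>p q. ((\<lambda>w. c * f (fst w) (snd w)) has_derivative (\<lambda>h. p * fst h + q * snd h)) (at z)" if z: "z \<in> U" for z
  proof -
    obtain p q where "((\<lambda>w. f (fst w) (snd w)) has_derivative (\<lambda>h. p * fst h + q * snd h)) (at z)"
      using D[OF z] by blast
    from has_derivative_mult_right[OF this, of c]
    have "((\<lambda>w. c * f (fst w) (snd w)) has_derivative (\<lambda>h. (c * p) * fst h + (c * q) * snd h)) (at z)"
      by (simp add: distrib_left mult.assoc)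
    then show ?thesis by blast
  qed
  with U show ?thesis unfolding analytic2_on_def by blast
qed

lemma kernel_perturbation_decay:
  fixes A B :: "complex \<Rightarrow> complex \<Rightarrow> complex"
  assumes A_analytic: "analytic2_on A (complex_of_real ` {-1..1} \<times> complex_of_real ` {-1..1})"
    and B_analytic: "analytic2_on B (complex_of_real ` {-1..1} \<times> complex_of_real ` {-1..1})"
    and A_diag: "\<And>x::real. x \<in> {-1..1} \<Longrightarrow> A (of_real x) (of_real x) = of_real (- 1 / (2 * pi))"
  defines "KA \<equiv> \<lambda>x y. of_real pi * A (complex_of_real x) (complex_of_real y)"
    and "KB \<equiv> \<lambda>x y. of_real pi * B (complex_of_real x) (complex_of_real y)"
  obtains C t where "0 < t" "t < 1"
    "\<And>i j. cmod (((log_kernel_mat KA \<oplus>\<^sub>M sum_kernel_mat KB) \<otimes>\<^sub>M R_mat) i j - diag_mat (\<lambda>k. 1) i j)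
      \<le> C * t ^ ndist i j / (real i + 1)"
proof -
  obtain C1 q1 where q1: "0 < q1" "q1 < 1" and k1: "\<And>m n. norm (cheb_coeff2 KA m n) \<le> C1 * q1 ^ (m + n)"
    and k1': "\<And>x n. x \<in> {-1..1} \<Longrightarrow> norm (cheb_coeff (KA x) n) \<le> C1 * q1 ^ n"
    and cA: "continuous_on ({-1..1} \<times> {-1..1}) (\<lambda>(x, y). KA x y)"
    by (rule cheb_coeff2_decay[OF analytic2_on_cmult[OF A_analytic, of "of_real pi"] meta_eq_to_obj_eq[OF KA_def]]) (rule that)
  obtain C2 q2 where q2: "0 < q2" "q2 < 1" and k2: "\<And>m n. norm (cheb_coeff2 KB m n) \<le> C2 * q2 ^ (m + n)"
    and "\<And>x n. x \<in> {-1..1} \<Longrightarrow> norm (cheb_coeff (KB x) n) \<le> C2 * q2 ^ n"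
    and "continuous_on ({-1..1} \<times> {-1..1}) (\<lambda>(x, y). KB x y)"
    by (rule cheb_coeff2_decay[OF analytic2_on_cmult[OF B_analytic, of "of_real pi"] meta_eq_to_obj_eq[OF KB_def]]) (rule that)
  \<comment> \<open>A common rate for both kernels, so that a single \<open>t\<close> serves both
    bounds and they can be added.\<close>
  define q where "q = max q1 q2"
  have q: "0 < q" "q < 1" using q1 q2 by (auto simp: q_def)
  have "0 \<le> C1" "0 \<le> C2"
    using order_trans[OF norm_ge_zero k1[of 0 0]] order_trans[OF norm_ge_zero k2[of 0 0]] by simp_all
  then have mono: "C1 * q1 ^ k \<le> C1 * q ^ k" "C2 * q2 ^ k \<le> C2 * q ^ k" for k
    using q1 q2 by (auto simp: q_def intro!: mult_left_mono power_mono)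
  obtain t E where t: "0 < t" "t < 1" "0 \<le> E"
    and qt: "\<And>m n. q ^ (m + n) * ((real m + 1) * (real n + 1)) \<le> E * (t ^ (m + n) * t ^ (m + n))"
    using geometric_weight_bounds[OF q] by blast
  have diag: "KA x x = - 1 / 2" if "x \<in> {-1..1}" for x
    by (simp add: KA_def A_diag[OF that])
  obtain D1 where D1: "\<And>i j. cmod (log_kernel_mat KA i j * of_real (R_eigen j) - (if i = j then 1 else 0))
      \<le> D1 * t ^ ndist i j / (real i + 1)"
    by (rule log_kernel_perturbation[OF cA q order_trans[OF k1 mono(1)] order_trans[OF k1' mono(1)] diag t qt])
      (assumption | rule that)+
  obtain D2 where D2: "\<And>i j. cmod (sum_kernel_mat KB i j * of_real (R_eigen j)) \<le> D2 * t ^ ndist i j / (real i + 1)"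
    by (rule sum_kernel_bound[OF q order_trans[OF k2 mono(2)] t qt]) (rule that)
  show ?thesis
  proof (rule that[OF t(1,2), of "D1 + D2"])
    fix i j :: nat
    let ?P = "((log_kernel_mat KA \<oplus>\<^sub>M sum_kernel_mat KB) \<otimes>\<^sub>M R_mat) i j - diag_mat (\<lambda>k. 1) i j"
    have "?P = (log_kernel_mat KA i j * of_real (R_eigen j) - (if i = j then 1 else 0))
        + sum_kernel_mat KB i j * of_real (R_eigen j)"
      unfolding R_mat_eq mat_mult_diag_right by (simp add: mat_add_def diag_mat_def algebra_simps)
    then have "cmod ?P \<le> D1 * t ^ ndist i j / (real i + 1) + D2 * t ^ ndist i j / (real i + 1)"
      by (simp only: norm_triangle_le[OF add_mono[OF D1 D2]])
    then show "cmod ?P \<le> (D1 + D2) * t ^ ndist i j / (real i + 1)"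
      by (simp only: distrib_right add_divide_distrib)
  qed
qed

theorem lemma13:
  fixes A B :: "complex \<Rightarrow> complex \<Rightarrow> complex" and lam :: real
  assumes A_analytic: "analytic2_on A (complex_of_real ` {-1..1} \<times> complex_of_real ` {-1..1})"
    and B_analytic: "analytic2_on B (complex_of_real ` {-1..1} \<times> complex_of_real ` {-1..1})"
    and A_diag: "\<And>x::real. x \<in> {-1..1} \<Longrightarrow> A (of_real x) (of_real x) = of_real (- 1 / (2 * pi))"
  shows "maps_wl2 R_mat lam (lam - 1) \<and>
    (\<exists>K. (log_kernel_mat (\<lambda>x y. of_real pi * A (of_real x) (of_real y))
            \<oplus>\<^sub>M sum_kernel_mat (\<lambda>x y. of_real pi * B (of_real x) (of_real y))) \<otimes>\<^sub>M R_mat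
          = diag_mat (\<lambda>k. 1) \<oplus>\<^sub>M K
       \<and> compact_on_wl2 K lam)"
proof -
  define L where "L = log_kernel_mat (\<lambda>x y. of_real pi * A (of_real x) (of_real y))
      \<oplus>\<^sub>M sum_kernel_mat (\<lambda>x y. of_real pi * B (of_real x) (of_real y))"
  \<comment> \<open>The identity holds by construction, so the content lies in the entry bound. As
    \<open>K\<close> does not depend on \<open>lam\<close>, the same perturbation is compact on
    every space.\<close>
  define K where "K i j = (L \<otimes>\<^sub>M R_mat) i j - diag_mat (\<lambda>k. 1) i j" for i j
  obtain C t where "0 < t" "t < 1" "\<And>i j. cmod (K i j) \<le> C * t ^ ndist i j / (real i + 1)"
    by (rule kernel_perturbation_decay[OF A_analytic B_analytic A_diag, folded L_def K_def]) (assumption | rule that)+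
  then have "compact_on_wl2 K lam" by (rule compact_on_wl2I)
  moreover have "L \<otimes>\<^sub>M R_mat = diag_mat (\<lambda>k. 1) \<oplus>\<^sub>M K"
    by (simp add: fun_eq_iff mat_add_def[of "diag_mat _"] K_def)
  ultimately show ?thesis
    unfolding L_def using maps_wl2_R_mat by blast
qed

end
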